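(* Let $q$ be a prime power, $n\ge1$, and let $k$ be an integer with $1\le k\le n$ and $k\equiv 2 \pmod 4$. Let $U\subseteq H_n(\mathbb{F}_{q^2})$ be any constant rank-distance $k$ set. Then \[ |U|\le 1+\prod_{i=1}^k\left(q^{n-i+1}+(-1)^{n-i+1}\right). \]
   Context: $H_n(\mathbb{F}_{q^2})$ is the set of $n\times n$ hermitian matrices over $\mathbb{F}_{q^2}$ (matrices $A$ with $\overline{A}^T=A$, $\overline{\cdot}$ being $x\mapsto x^q$ entrywise). A constant rank-distance $k$ set is a set $U$ of $n\times n$ matrices with $\mathrm{rank}(A-B)=k$ for all distinct $A,B\in U$ and $\mathrm{rank}(A)=k$ for all nonzero $A\in U$. *)

theory Defs
  imports
    "HOL-Library.Cardinality"
    "HOL-Number_Theory.Number_Theory"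
    "Jordan_Normal_Form.DL_Rank"
begin

text \<open>Over a field with \<open>q\<^sup>2\<close> elements, \<open>x \<mapsto> x ^ q\<close> is the involutory automorphism
  fixing the subfield with \<open>q\<close> elements; it is applied entrywise.\<close>

definition hermitian_mats :: "nat \<Rightarrow> nat \<Rightarrow> 'a :: field mat set" where
  "hermitian_mats q n =
     {A \<in> carrier_mat n n. transpose_mat (map_mat (\<lambda>x. x ^ q) A) = A}"

text \<open>The zero matrix may, but need not, belong to \<open>U\<close>.\<close>

definition constant_rank_distance_set :: "nat \<Rightarrow> nat \<Rightarrow> 'a :: field mat set \<Rightarrow> bool" where
  "constant_rank_distance_set n k U \<longleftrightarrow>
     U \<subseteq> carrier_mat n n \<and>
     (\<forall>A\<in>U. \<forall>B\<in>U. A \<noteq> B \<longrightarrow> vec_space.rank n (A - B) = k) \<and>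
     (\<forall>A\<in>U. A \<noteq> 0\<^sub>m n n \<longrightarrow> vec_space.rank n A = k)"

end

theory Submission
  imports Defs "HOL-Library.Function_Algebras"
begin

text \<open>Fix an additive character \<open>\<chi>\<close> of the field that is nontrivial on the subfield with \<open>q\<close>
  elements, and put \<open>S(A) = \<Sum>X. \<chi> (tr (X A X\<^sup>*))\<close>, summed over all invertible \<open>X\<close>. Expanding
  \<open>0 \<le> \<Sum>X. \<bar>\<Sum>A\<in>U. \<chi> (tr (X A X\<^sup>*))\<bar>\<^sup>2\<close> gives \<open>0 \<le> \<bar>U\<bar> S(0) + \<bar>U\<bar> (\<bar>U\<bar> - 1) S\<^sub>k\<close>, where \<open>S\<^sub>k\<close> is the value
  of \<open>S\<close> at hermitian matrices of rank \<open>k\<close>. With \<open>b = - q\<close> one has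
  \<open>S(0) = S\<^sub>k * (\<Prod>i<k. b ^ (n - i) + 1)\<close>, and for \<open>k \<equiv> 2 (mod 4)\<close> this product is negative: it is
  the negative of the product in the bound.

  Congruence reduces the computation of \<open>S\<^sub>k\<close> to the sum of \<open>\<chi> (\<Sum>j. h r\<^sub>j r\<^sub>j)\<close> over all lists of \<open>m\<close>
  vectors \<open>r\<^sub>j\<close> that span a nondegenerate hermitian space \<open>(V, h)\<close> of dimension \<open>k\<close>. This sum is
  \<open>\<Prod>i<k. b ^ (m + i) - b ^ (2 * i)\<close>, by induction on \<open>m\<close>: the first \<open>m\<close> vectors span \<open>V\<close> or a
  hyperplane \<open>a\<^sup>\<bottom>\<close>, the hyperplanes with \<open>a\<close> isotropic contribute nothing, and the others
  are again nondegenerate.\<close>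

section \<open>Additive characters and the hermitian structure of the field\<close>

lemma finite_field_power_card:
  fixes x :: "'a :: {field, finite}"
  shows "x ^ CARD('a) = x"
proof (cases "x = 0")
  case False
  \<comment> \<open>Multiplication by a nonzero \<open>x\<close> permutes the nonzero elements;
    cancelling their product leaves \<open>x ^ (CARD('a) - 1) = 1\<close>.\<close>
  have "(\<Prod>y\<in>UNIV - {0}. x * y) = (\<Prod>y\<in>UNIV - {0}. y)"
    by (rule prod.reindex_bij_witness[of _ "\<lambda>y. y / x" "\<lambda>y. x * y"]) (use False in auto)
  then have "x ^ (CARD('a) - 1) = 1"
    by (simp add: prod.distrib)
  then show ?thesis
    by (metis One_nat_def Suc_diff_1 finite_UNIV_card_ge_0 finite_class.finite_UNIV mult.right_neutral power_Suc)
qed (simp add: zero_power finite_UNIV_card_ge_0)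

lemma finite_field_CHAR:
  assumes "CARD('a :: {field, finite}) = p ^ e" and "prime p"
  shows "CHAR('a :: {field, finite}) = p"
proof -
  have "prime CHAR('a)"
    by (rule prime_CHAR_semidom) (simp add: finite_imp_CHAR_pos)
  moreover have "CHAR('a) dvd p ^ e"
    using CHAR_dvd_CARD[where 'a='a] assms(1) by simp
  ultimately show ?thesis
    using assms(2) by (metis prime_dvd_power_nat primes_dvd_imp_eq)
qed

text \<open>With \<open>m = q - 1\<close> or \<open>m = q + 1\<close> this bounds the nonzero fixed
  elements of conjugation, the norm fibres, and the nonzero \<open>t\<close> with
  \<open>t ^ q = - t\<close>.\<close>

lemma card_nth_roots_le:
  fixes c :: "'a :: idom"
  assumes "m > 0"
  shows "card {x. x ^ m = c} \<le> m"
proof -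
  let ?p = "monom 1 m - [:c:]"
  have "coeff ?p m = 1"
    using assms by (simp add: coeff_pCons split: nat.split)
  then have "?p \<noteq> 0"
    by (metis coeff_0 zero_neq_one)
  moreover have "degree ?p \<le> m"
    by (intro degree_diff_le degree_monom_le) simp
  ultimately have "card {x. poly ?p x = 0} \<le> m"
    using card_poly_roots_bound[of ?p] by linarith
  then show ?thesis
    by (simp add: poly_monom)
qed

text \<open>The character is \<open>\<zeta> ^ Tr x\<close>, where \<open>Tr\<close> is the absolute trace.\<close>

lemma exists_additive_character:
  assumes "primepow CARD('a :: {field, finite})"
  obtains \<chi> :: "'a :: {field, finite} \<Rightarrow> complex" where
    "\<And>x y. \<chi> (x + y) = \<chi> x * \<chi> y" "\<And>x. norm (\<chi> x) = 1" "\<chi> 1 \<noteq> 1"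
proof -
  from assms obtain p e where p: "prime p" and e: "e > 0" and card: "CARD('a) = p ^ e"
    by (auto simp: primepow_def)
  have char: "CHAR('a) = p"
    using card p by (rule finite_field_CHAR)
  define Tr where "Tr x = (\<Sum>i<e. x ^ (p ^ i))" for x :: 'a
  have Tr_add: "Tr (x + y) = Tr x + Tr y" for x y
    unfolding Tr_def sum.distrib[symmetric]
    by (intro sum.cong refl freshmans_dream') (auto simp: char p)
  \<comment> \<open>Frobenius shifts the summands cyclically: the last one becomes
    \<open>x ^ CARD('a) = x\<close>.\<close>
  have Tr_p: "Tr x ^ p = Tr x" for x
  proof -
    obtain e' where e': "e = Suc e'"
      using e gr0_implies_Suc by blast
    have "Tr x ^ p = (\<Sum>i<e. x ^ (p ^ Suc i))"
      unfolding Tr_def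
      by (subst freshmans_dream_sum) (auto simp: char p power_mult[symmetric] mult.commute)
    also have "\<dots> = (\<Sum>i<e'. x ^ (p ^ Suc i)) + x ^ CARD('a)"
      by (simp add: e' card)
    also have "\<dots> = x ^ (p ^ 0) + (\<Sum>i<e'. x ^ (p ^ Suc i))"
      by (simp only: finite_field_power_card power_0 power_one_right add.commute)
    also have "\<dots> = Tr x"
      unfolding Tr_def e' by (rule sum.lessThan_Suc_shift[symmetric])
    finally show ?thesis .
  qed
  have p0: "p > 0"
    using p prime_gt_0_nat by blast
  have inj: "inj_on (of_nat :: nat \<Rightarrow> 'a) {..<p}"
    by (rule inj_onI) (auto simp: of_nat_eq_iff_cong_CHAR char cong_def)
  have fermat: "(of_nat j :: 'a) ^ p = of_nat j" for j
  proof (induction j)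
    case (Suc j)
    then show ?case
      using freshmans_dream[OF _ char[symmetric], of 1 "of_nat j"] p
      by (simp add: char)
  qed (simp add: p0)
  \<comment> \<open>The prime field already supplies \<open>p\<close> roots of
    \<open>x ^ p = x\<close>, as many as the degree allows, so every trace value is the image of a
    natural number.\<close>
  have roots: "of_nat ` {..<p} = {x :: 'a. x ^ p = x}"
  proof (rule card_subset_eq)
    let ?p = "monom 1 p - [:0, 1 :: 'a:]"
    have p1: "p > 1" using p prime_gt_1_nat by blast
    then have "coeff ?p p = 1"
      by (auto simp: coeff_pCons split: nat.split)
    then have "?p \<noteq> 0"
      by (metis coeff_0 zero_neq_one)
    moreover have "degree ?p \<le> p"
      using p1 by (intro degree_diff_le degree_monom_le) simp
    ultimately have "card {x. poly ?p x = 0} \<le> p"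
      using card_poly_roots_bound[of ?p] by linarith
    then have le: "card {x :: 'a. x ^ p = x} \<le> p"
      by (simp add: poly_monom)
    show sub: "of_nat ` {..<p} \<subseteq> {x :: 'a. x ^ p = x}"
      using fermat by auto
    show "card (of_nat ` {..<p} :: 'a set) = card {x :: 'a. x ^ p = x}"
      using le card_mono[OF _ sub] by (simp add: card_image inj)
  qed simp
  \<comment> \<open>The representative is determined only modulo \<open>p\<close>; since
    \<open>\<zeta> ^ p = 1\<close>, the choice does not affect
    \<open>\<zeta> ^ idx x\<close>.\<close>
  define idx where "idx x = (SOME j. of_nat j = Tr x)" for x
  have idx: "of_nat (idx x) = Tr x" for x
  proof -
    have "Tr x \<in> of_nat ` {..<p}"
      unfolding roots using Tr_p by simp
    then have "\<exists>j. of_nat j = Tr x" by force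
    then show ?thesis
      unfolding idx_def by (rule someI_ex)
  qed
  define \<zeta> where "\<zeta> = cis (2 * pi / real p)"
  have zeta_pow: "\<zeta> ^ j = cis (2 * pi * real j / real p)" for j
    unfolding \<zeta>_def by (simp add: DeMoivre mult_ac)
  have zeta_p: "\<zeta> ^ p = 1"
    using p0 by (simp add: zeta_pow)
  have zeta_mod: "\<zeta> ^ (j mod p) = \<zeta> ^ j" for j
    using zeta_p by (metis mod_mult_div_eq mult_1_right power_add power_mult power_one)
  have zeta_cong: "\<zeta> ^ i = \<zeta> ^ j" if "(of_nat i :: 'a) = of_nat j" for i j
  proof -
    have "i mod p = j mod p"
      using that by (simp add: of_nat_eq_iff_cong_CHAR char cong_def)
    then show ?thesis
      by (metis zeta_mod)
  qed
  define \<chi> where "\<chi> x = \<zeta> ^ idx x" for x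
  have chi_add: "\<chi> (x + y) = \<chi> x * \<chi> y" for x y
    unfolding \<chi>_def power_add[symmetric]
    by (rule zeta_cong) (simp add: idx Tr_add)
  have chi_norm: "norm (\<chi> x) = 1" for x
    by (simp add: \<chi>_def norm_power \<zeta>_def)
  \<comment> \<open>As a polynomial, the trace has linear coefficient 1 and degree at most
    \<open>p ^ (e - 1)\<close>, so it cannot vanish at all \<open>p ^ e\<close> elements.\<close>
  have "\<exists>x. Tr x \<noteq> 0"
  proof (rule ccontr)
    assume "\<not> ?thesis"
    then have all: "Tr x = 0" for x by blast
    let ?P = "\<Sum>i<e. monom 1 (p ^ i) :: 'a poly"
    have p1: "p > 1" using p prime_gt_1_nat by blast
    have "coeff ?P (p ^ 0) = (\<Sum>i<e. if i = 0 then 1 else 0)"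
      unfolding coeff_sum coeff_monom
      by (intro sum.cong refl if_cong) (use p1 in \<open>auto simp: power_inject_exp\<close>)
    also have "\<dots> = 1"
      using e by simp
    finally have "?P \<noteq> 0"
      by (metis coeff_0 zero_neq_one)
    moreover have "{x. poly ?P x = 0} = UNIV"
      using all by (simp add: poly_sum poly_monom Tr_def)
    ultimately have "CARD('a) \<le> degree ?P"
      using card_poly_roots_bound[of ?P] by simp
    also have "\<dots> \<le> p ^ (e - 1)"
      by (rule degree_sum_le)
        (use p1 in \<open>auto intro!: order.trans[OF degree_monom_le] power_increasing\<close>)
    also have "\<dots> < p ^ e"
      using p1 e by (intro power_strict_increasing) auto
    finally show False
      using card by simp
  qed
  then obtain x0 where x0: "Tr x0 \<noteq> 0" by blast
  have "\<chi> x0 \<noteq> 1"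
  proof
    assume "\<chi> x0 = 1"
    then have "\<zeta> ^ (idx x0 mod p) = \<zeta> ^ 0"
      by (simp add: zeta_mod \<chi>_def)
    moreover have "inj_on (\<lambda>k. \<zeta> ^ k) {..<p}"
      unfolding zeta_pow using bij_betw_roots_unity[OF p0] by (rule bij_betw_imp_inj_on)
    ultimately have "idx x0 mod p = 0"
      using p0 by (metis inj_onD lessThan_iff mod_less_divisor)
    then have "of_nat (idx x0) = (0 :: 'a)"
      by (simp add: of_nat_eq_0_iff_char_dvd char mod_eq_0_iff_dvd)
    then show False
      using idx x0 by simp
  qed
  \<comment> \<open>Rescaling the argument by \<open>x0\<close> moves the nontrivial value to
    1.\<close>
  then show thesis
    by (intro that[of "\<lambda>x. \<chi> (x0 * x)"]) (simp_all add: chi_add chi_norm distrib_left)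
qed

section \<open>Norms and traces to the fixed field of conjugation, and their character sums\<close>

locale hermitian_field =
  fixes q :: nat and \<chi> :: "'a :: {field, finite} \<Rightarrow> complex"
  assumes primepow_q: "primepow q"
    and card_field: "CARD('a) = q ^ 2"
    and chi_add: "\<chi> (x + y) = \<chi> x * \<chi> y"
    and norm_chi: "norm (\<chi> x) = 1"
    and chi_1: "\<chi> 1 \<noteq> 1"
begin

lemma q_gt_1: "q > 1"
  using primepow_q primepow_gt_Suc_0 by auto

lemma chi_0 [simp]: "\<chi> 0 = 1"
  using chi_add[of 0 0] norm_chi[of 0] by auto

lemma conj_add: "(x + y :: 'a) ^ q = x ^ q + y ^ q"
proof -
  from primepow_q obtain p e where p: "prime p" and q: "q = p ^ e"
    by (auto simp: primepow_def)
  have "CHAR('a) = p"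
    using card_field p by (intro finite_field_CHAR[of p "e * 2"]) (simp_all add: q power_mult)
  then show ?thesis
    using freshmans_dream'[of q e x y] p q by simp
qed

lemma conj_sum: "(sum f A :: 'a) ^ q = (\<Sum>x\<in>A. f x ^ q)"
  using q_gt_1 by (induction A rule: infinite_finite_induct) (auto simp: conj_add)

lemma conj_conj [simp]: "((x :: 'a) ^ q) ^ q = x"
  using finite_field_power_card[of x] by (simp add: card_field power2_eq_square power_mult)

lemma conj_eq_0_iff [simp]: "(x :: 'a) ^ q = 0 \<longleftrightarrow> x = 0"
  using q_gt_1 by simp

lemma conj_minus: "(- x :: 'a) ^ q = - (x ^ q)"
proof -
  have "(- x) ^ q + x ^ q = (- x + x) ^ q"
    by (rule conj_add[symmetric])
  then show ?thesis
    using q_gt_1 by (simp add: eq_neg_iff_add_eq_0)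
qed

lemma chi_minus: "\<chi> (- x) = cnj (\<chi> x)"
proof -
  have "\<chi> (- x) * \<chi> x = 1"
    by (simp flip: chi_add)
  moreover have "cnj (\<chi> x) * \<chi> x = 1"
    using complex_norm_square[of "\<chi> x"] by (simp add: norm_chi mult.commute)
  moreover have "\<chi> x \<noteq> 0"
    using norm_chi[of x] by auto
  ultimately show ?thesis
    by (metis mult_cancel_right)
qed

abbreviation "fixed_field \<equiv> {c :: 'a. c ^ q = c}"

text \<open>Root counting gives at most \<open>q - 1\<close> fixed units and at most
  \<open>q + 1\<close> elements in each norm fibre. The fibres over the fixed units partition the
  \<open>(q - 1) * (q + 1)\<close> nonzero elements, so both bounds are attained.\<close>

lemma
  shows card_fixed_units: "card (fixed_field - {0}) = q - 1"
    and card_norm_fibre: "c \<in> fixed_field - {0} \<Longrightarrow> card {t. t * t ^ q = c} = q + 1"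
proof -
  let ?F = "fixed_field - {0}" and ?N = "\<lambda>c. {t :: 'a. t * t ^ q = c}"
  have "?F \<subseteq> {x. x ^ (q - 1) = 1}"
  proof
    fix x assume "x \<in> ?F"
    then have "x ^ (q - 1) * x = 1 * x" "x \<noteq> 0"
      using q_gt_1 by (auto simp flip: power_Suc2)
    then show "x \<in> {x. x ^ (q - 1) = 1}" by simp
  qed
  then have F: "card ?F \<le> q - 1"
    using card_nth_roots_le[of "q - 1" "1 :: 'a"] q_gt_1
    by (meson card_mono finite le_trans zero_less_diff)
  have N: "card (?N c) \<le> q + 1" for c
    using card_nth_roots_le[of "q + 1" c] by simp
  have "UNIV - {0} = (\<Union>c\<in>?F. ?N c)"
    using q_gt_1 by (auto simp: power_mult_distrib)
  then have "card (UNIV - {0 :: 'a}) = card (\<Union>c\<in>?F. ?N c)"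
    by simp
  also have "\<dots> = (\<Sum>c\<in>?F. card (?N c))"
    by (rule card_UN_disjoint) auto
  finally have sum: "(\<Sum>c\<in>?F. card (?N c)) = (q - 1) * (q + 1)"
    by (simp add: card_field power2_eq_square algebra_simps)
  have "(\<Sum>c\<in>?F. card (?N c)) \<le> card ?F * (q + 1)"
    using sum_bounded_above[of ?F "\<lambda>c. card (?N c)" "q + 1"] N by simp
  then have "q - 1 \<le> card ?F"
    unfolding sum mult_le_cancel2 by simp
  with F show *: "card ?F = q - 1" by simp
  show "card (?N c) = q + 1" if "c \<in> ?F"
  proof (rule ccontr)
    assume "card (?N c) \<noteq> q + 1"
    then have "card (?N c) < q + 1"
      using N[of c] by simp
    then have "(\<Sum>c\<in>?F. card (?N c)) < (\<Sum>c\<in>?F. q + 1)"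
      using that N by (intro sum_strict_mono_ex1) auto
    then show False
      unfolding sum using * by simp
  qed
qed

lemma card_fixed_field: "card fixed_field = q"
  using card_fixed_units q_gt_1 by (simp add: card_Diff_singleton)

text \<open>Scaling reduces to \<open>d = 1\<close>, and translation by 1 multiplies the sum by
  \<open>\<chi> 1\<close>, which is not 1.\<close>

lemma sum_chi_fixed_field:
  assumes "d \<in> fixed_field - {0}"
  shows "(\<Sum>c\<in>fixed_field. \<chi> (c * d)) = 0"
proof -
  have "(\<Sum>c\<in>fixed_field. \<chi> (c * d)) = (\<Sum>c\<in>fixed_field. \<chi> c)"
    by (rule sum.reindex_bij_witness[of _ "\<lambda>c. c / d" "\<lambda>c. c * d"])
      (use assms in \<open>auto simp: power_mult_distrib power_divide\<close>)
  also have "\<dots> = (\<Sum>c\<in>fixed_field. \<chi> (1 + c))"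
    by (rule sum.reindex_bij_witness[of _ "\<lambda>c. 1 + c" "\<lambda>c. c + - 1"])
      (auto simp: conj_add conj_minus simp del: add_uminus_conv_diff)
  also have "\<dots> = \<chi> 1 * (\<Sum>c\<in>fixed_field. \<chi> c)"
    by (simp add: chi_add sum_distrib_left)
  finally show ?thesis
    using chi_1 \<open>(\<Sum>c\<in>fixed_field. \<chi> (c * d)) = (\<Sum>c\<in>fixed_field. \<chi> c)\<close>
    by (metis mult_cancel_right1)
qed

text \<open>Sort \<open>t\<close> by its norm: 0 is attained once, every fixed unit
  \<open>q + 1\<close> times. As the character sum over the whole fixed field vanishes, the units
  contribute \<open>- (q + 1)\<close>. This is the Gauss sum of a one-dimensional form.\<close>

lemma sum_chi_norm:
  assumes "d \<in> fixed_field - {0}"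
  shows "(\<Sum>t\<in>UNIV. \<chi> (d * (t * t ^ q))) = - of_nat q"
proof -
  let ?N = "\<lambda>c. {t \<in> UNIV :: 'a set. t * t ^ q = c}"
  have N0: "?N 0 = {0}"
    using q_gt_1 by auto
  have "(\<Sum>t\<in>UNIV. \<chi> (d * (t * t ^ q))) = (\<Sum>c\<in>fixed_field. \<Sum>t\<in>?N c. \<chi> (d * (t * t ^ q)))"
    by (rule sum.group[symmetric]) (auto simp: power_mult_distrib)
  also have "\<dots> = (\<Sum>c\<in>fixed_field. of_nat (card (?N c)) * \<chi> (c * d))"
    by (intro sum.cong refl) (simp add: mult.commute)
  also have "\<dots> = 1 + (\<Sum>c\<in>fixed_field - {0}. of_nat (card (?N c)) * \<chi> (c * d))"
    using q_gt_1 by (subst sum.remove[of _ 0]) (auto simp: N0)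
  also have "(\<Sum>c\<in>fixed_field - {0}. of_nat (card (?N c)) * \<chi> (c * d)) =
      of_nat (q + 1) * (\<Sum>c\<in>fixed_field - {0}. \<chi> (c * d))"
    unfolding sum_distrib_left using card_norm_fibre by (intro sum.cong refl) simp
  also have "(\<Sum>c\<in>fixed_field - {0}. \<chi> (c * d)) = (\<Sum>c\<in>fixed_field. \<chi> (c * d)) - 1"
    using q_gt_1 by (subst sum_diff1) auto
  also have "\<dots> = - 1"
    using sum_chi_fixed_field[OF assms] by simp
  finally show ?thesis by simp
qed

text \<open>If the trace vanished identically, \<open>t ^ (q - 1) = - 1\<close> would have
  \<open>q ^ 2 - 1\<close> solutions. A nonzero trace is fixed by conjugation, so dividing by it
  normalizes the trace to 1.\<close>

lemma exists_trace_1: "\<exists>w :: 'a. w + w ^ q = 1"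
proof -
  have "\<exists>t :: 'a. t + t ^ q \<noteq> 0"
  proof (rule ccontr)
    assume "\<not> ?thesis"
    then have *: "t ^ q = - t" for t :: 'a
      by (metis add_eq_0_iff)
    have "UNIV - {0 :: 'a} \<subseteq> {t. t ^ (q - 1) = - 1}"
    proof
      fix t :: 'a assume "t \<in> UNIV - {0}"
      then have "t ^ (q - 1) * t = - 1 * t" "t \<noteq> 0"
        using q_gt_1 *[of t] by (auto simp flip: power_Suc2)
      then show "t \<in> {t. t ^ (q - 1) = - 1}"
        unfolding mult_cancel_right by simp
    qed
    then have "card (UNIV - {0 :: 'a}) \<le> q - 1"
      using card_nth_roots_le[of "q - 1" "- 1 :: 'a"] q_gt_1
      by (meson card_mono finite le_trans zero_less_diff)
    then have "q * q - 1 \<le> q - 1"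
      by (simp add: card_field power2_eq_square)
    moreover have "1 * q < q * q"
      using q_gt_1 by (intro mult_strict_right_mono) auto
    ultimately show False
      using q_gt_1 by linarith
  qed
  then obtain t :: 'a where t: "t + t ^ q \<noteq> 0" by blast
  have "(t + t ^ q) ^ q = t + t ^ q"
    by (simp add: conj_add add.commute)
  then have "t / (t + t ^ q) + (t / (t + t ^ q)) ^ q = 1"
    using t by (simp add: power_divide flip: add_divide_distrib)
  then show ?thesis by blast
qed

text \<open>The map taking \<open>x\<close> to \<open>\<chi> (x + x ^ q)\<close> is itself an
  additive character, with value \<open>\<chi> 1\<close> at an element of trace 1.\<close>

lemma sum_chi_trace:
  assumes "z \<noteq> 0"
  shows "(\<Sum>t\<in>UNIV. \<chi> (t * z + (t * z) ^ q)) = 0"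
proof -
  let ?f = "\<lambda>x. \<chi> (x + x ^ q)"
  obtain w :: 'a where w: "w + w ^ q = 1"
    using exists_trace_1 by blast
  have f_add: "?f (x + y) = ?f x * ?f y" for x y
    by (simp add: conj_add add_ac flip: chi_add)
  have "(\<Sum>t\<in>UNIV. ?f (t * z)) = (\<Sum>x\<in>UNIV. ?f x)"
    by (rule sum.reindex_bij_witness[of _ "\<lambda>c. c / z" "\<lambda>c. c * z"]) (use assms in auto)
  moreover have "sum ?f UNIV = (\<Sum>x\<in>UNIV. ?f (w + x))"
    by (rule sum.reindex_bij_witness[of _ "\<lambda>c. w + c" "\<lambda>c. c - w"]) auto
  then have "sum ?f UNIV = \<chi> 1 * sum ?f UNIV"
    by (simp only: f_add w sum_distrib_left[symmetric])
  ultimately show ?thesis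
    using chi_1 by (metis mult_cancel_right1)
qed

end

section \<open>Character sums over nondegenerate hermitian spaces\<close>

locale hermitian_form = hermitian_field q \<chi> + vector_space scale
  for q :: nat and \<chi> :: "'a :: {field, finite} \<Rightarrow> complex"
    and scale :: "'a \<Rightarrow> 'b :: ab_group_add \<Rightarrow> 'b" (infixr "*s" 75) +
  fixes h :: "'b \<Rightarrow> 'b \<Rightarrow> 'a"
  assumes h_add: "h (x + y) z = h x z + h y z"
    and h_scale: "h (c *s x) y = c * h x y"
    and h_conj: "h y x = h x y ^ q"
begin

lemma h_add_right: "h x (y + z) = h x y + h x z"
  using h_conj[of x "y + z"] h_conj[of x y] h_conj[of x z] by (simp add: h_add conj_add)

lemma h_scale_right: "h x (c *s y) = c ^ q * h x y"
  using h_conj[of x "c *s y"] h_conj[of x y] by (simp add: h_scale power_mult_distrib)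

lemma h_0 [simp]: "h 0 x = 0"
  using h_scale[of 0 0 x] by simp

lemma h_0_right [simp]: "h x 0 = 0"
  using h_add_right[of x 0 0] by (metis add.right_neutral add_cancel_right_right)

lemma h_diff_right: "h x (y - z) = h x y - h x z"
  using h_add_right[of x "y - z" z] by simp

lemma h_diff: "h (x - y) z = h x z - h y z"
  using h_add[of "x - y" y z] by simp

lemma h_eq_0_commute: "h x y = 0 \<longleftrightarrow> h y x = 0"
  using h_conj[of x y] h_conj[of y x] by (metis conj_eq_0_iff)

lemma h_self_fixed: "h x x ^ q = h x x"
  using h_conj[of x x] by simp

section \<open>Orthogonal splitting at an anisotropic vector, and Gauss sums\<close>

definition nondegenerate :: "'b set \<Rightarrow> bool" where
  "nondegenerate V \<longleftrightarrow> finite V \<and> subspace V \<and> (\<forall>a\<in>V. (\<forall>x\<in>V. h x a = 0) \<longrightarrow> a = 0)"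

definition perp :: "'b set \<Rightarrow> 'b \<Rightarrow> 'b set" where
  "perp V a = {x \<in> V. h x a = 0}"

definition gauss_sum :: "'b set \<Rightarrow> complex" where
  "gauss_sum V = (\<Sum>x\<in>V. \<chi> (h x x))"

text \<open>The orthogonal decomposition of \<open>V\<close> into the line of \<open>a\<close> and
  its complement; \<open>h v a / h a a\<close> is the coefficient of the projection onto that
  line.\<close>

lemma bij_betw_perp:
  assumes "subspace V" "a \<in> V" "h a a \<noteq> 0"
  shows "bij_betw (\<lambda>(t, x). t *s a + x) (UNIV \<times> perp V a) V"
proof (rule bij_betw_byWitness[where f' = "\<lambda>v. (h v a / h a a, v - (h v a / h a a) *s a)"])
  show "\<forall>p\<in>UNIV \<times> perp V a. (\<lambda>v. (h v a / h a a, v - (h v a / h a a) *s a)) ((\<lambda>(t, x). t *s a + x) p) = p"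
    using assms(3) by (auto simp: perp_def h_add h_scale)
  show "(\<lambda>(t, x). t *s a + x) ` (UNIV \<times> perp V a) \<subseteq> V"
    using assms by (auto simp: perp_def intro: subspace_add subspace_scale)
  show "(\<lambda>v. (h v a / h a a, v - (h v a / h a a) *s a)) ` V \<subseteq> UNIV \<times> perp V a"
    using assms by (auto simp: perp_def h_diff h_scale intro: subspace_diff subspace_scale)
qed auto

lemma sum_perp:
  assumes "subspace V" "a \<in> V" "h a a \<noteq> 0"
  shows "(\<Sum>v\<in>V. f v) = (\<Sum>t\<in>UNIV. \<Sum>x\<in>perp V a. f (t *s a + x))"
  using sum.reindex_bij_betw[OF bij_betw_perp[OF assms], of f]
  by (simp add: sum.cartesian_product case_prod_unfold)

lemma card_perp:
  assumes "subspace V" "a \<in> V" "h a a \<noteq> 0"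
  shows "card V = q ^ 2 * card (perp V a)"
  using bij_betw_same_card[OF bij_betw_perp[OF assms]]
  by (simp add: card_cartesian_product card_field)

lemma perp_decompose:
  assumes "subspace V" "a \<in> V" "h a a \<noteq> 0" "v \<in> V"
  obtains t x where "x \<in> perp V a" "v = t *s a + x"
proof -
  have "v \<in> (\<lambda>(t, x). t *s a + x) ` (UNIV \<times> perp V a)"
    using bij_betw_imp_surj_on[OF bij_betw_perp[OF assms(1-3)]] assms(4) by simp
  then show thesis
    using that by auto
qed

lemma subspace_perp: "subspace V \<Longrightarrow> subspace (perp V a)"
  unfolding subspace_def perp_def by (auto simp: h_add h_scale)

text \<open>A vector of \<open>perp V a\<close> that is orthogonal to \<open>perp V a\<close> is
  orthogonal to \<open>a\<close> as well, hence to all of \<open>V\<close>.\<close>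

lemma nondegenerate_perp:
  assumes "nondegenerate V" "a \<in> V" "h a a \<noteq> 0"
  shows "nondegenerate (perp V a)"
  unfolding nondegenerate_def
proof (intro conjI ballI impI)
  have V: "subspace V" "finite V"
    using assms(1) by (auto simp: nondegenerate_def)
  then show "finite (perp V a)" "subspace (perp V a)"
    by (auto simp: perp_def[of V] intro: subspace_perp[unfolded perp_def])
  fix y assume y: "y \<in> perp V a" "\<forall>x\<in>perp V a. h x y = 0"
  have "h v y = 0" if "v \<in> V" for v
  proof -
    obtain t x where x: "x \<in> perp V a" and v: "v = t *s a + x"
      using perp_decompose[OF V(1) assms(2,3) \<open>v \<in> V\<close>] by blast
    have "h a y = 0"
      using y(1) h_eq_0_commute[of y a] by (simp add: perp_def)
    then show ?thesis
      using x y(2) by (simp add: v h_add h_scale)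
  qed
  then show "y = 0"
    using assms(1) y(1) by (auto simp: nondegenerate_def perp_def)
qed

text \<open>Polarization: if all \<open>h a a\<close> were 0, expanding at \<open>t *s y + x\<close>
  would make the trace of \<open>t * h y x\<close> vanish for every \<open>t\<close>, and the sum in
  \<open>sum_chi_trace\<close> would be \<open>q ^ 2\<close> instead of 0. Characteristic 2 is
  covered too.\<close>

lemma exists_anisotropic:
  assumes "nondegenerate V" "V \<noteq> {0}"
  obtains a where "a \<in> V" "h a a \<noteq> 0"
proof -
  have V: "subspace V"
    using assms(1) by (simp add: nondegenerate_def)
  then obtain x where x: "x \<in> V" "x \<noteq> 0"
    using assms(2) subspace_0 by auto
  then obtain y where y: "y \<in> V" "h y x \<noteq> 0"
    using assms(1) by (auto simp: nondegenerate_def)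
  have "\<exists>a\<in>V. h a a \<noteq> 0"
  proof (rule ccontr)
    assume "\<not> ?thesis"
    then have iso: "h a a = 0" if "a \<in> V" for a
      using that by blast
    have "t * h y x + (t * h y x) ^ q = 0" for t
    proof -
      have "h (t *s y + x) (t *s y + x) = 0"
        using x y V by (intro iso subspace_add subspace_scale)
      then show ?thesis
        using iso[OF x(1)] iso[OF y(1)] h_conj[of x y]
        by (simp add: h_add h_add_right h_scale h_scale_right power_mult_distrib add.commute)
    qed
    then have "(\<Sum>t\<in>(UNIV :: 'a set). \<chi> 0) = 0"
      using sum_chi_trace[OF y(2)] by simp
    then show False
      using q_gt_1 by (simp add: card_field)
  qed
  then show thesis
    using that by blast
qed

text \<open>Orthogonality makes the sum factor, and the line of \<open>a\<close> contributes
  \<open>- q\<close> by \<open>sum_chi_norm\<close>.\<close>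

lemma gauss_sum_perp:
  assumes "subspace V" "a \<in> V" "h a a \<noteq> 0"
  shows "gauss_sum V = - of_nat q * gauss_sum (perp V a)"
proof -
  have "h (t *s a + x) (t *s a + x) = h a a * (t * t ^ q) + h x x" if "x \<in> perp V a" for t x
    using that h_eq_0_commute[of x a]
    by (simp add: perp_def h_add h_add_right h_scale h_scale_right mult_ac)
  then have "gauss_sum V = (\<Sum>t\<in>UNIV. \<Sum>x\<in>perp V a. \<chi> (h a a * (t * t ^ q)) * \<chi> (h x x))"
    unfolding gauss_sum_def by (simp add: sum_perp[OF assms] chi_add)
  also have "\<dots> = (\<Sum>t\<in>UNIV. \<chi> (h a a * (t * t ^ q))) * gauss_sum (perp V a)"
    unfolding gauss_sum_def sum_product ..
  finally show ?thesis
    using assms(3) by (simp add: sum_chi_norm h_self_fixed)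
qed

text \<open>Dimension \<open>k\<close> is recorded by the cardinality, the scalars being
  \<open>q ^ 2\<close> in number; splitting off an anisotropic vector lowers it by one.\<close>

lemma gauss_sum_nondegenerate:
  assumes "nondegenerate V" "card V = q ^ (2 * k)"
  shows "gauss_sum V = (- of_nat q) ^ k"
  using assms
proof (induction k arbitrary: V)
  case 0
  then have "V = {0}"
    using subspace_0 by (auto simp: nondegenerate_def card_1_singleton_iff)
  then show ?case
    by (simp add: gauss_sum_def)
next
  case (Suc k)
  have V: "subspace V"
    using Suc.prems(1) by (simp add: nondegenerate_def)
  have "1 < q ^ (2 * Suc k)"
    using q_gt_1 by (intro one_less_power) auto
  then have "V \<noteq> {0}"
    using Suc.prems(2) by auto
  then obtain a where a: "a \<in> V" "h a a \<noteq> 0"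
    using exists_anisotropic[OF Suc.prems(1)] by blast
  have "q ^ 2 * card (perp V a) = q ^ 2 * q ^ (2 * k)"
    using card_perp[OF V a] Suc.prems(2) by (simp flip: power_add)
  then have "card (perp V a) = q ^ (2 * k)"
    using q_gt_1 by simp
  then show ?case
    using Suc.IH[OF nondegenerate_perp[OF Suc.prems(1) a]] gauss_sum_perp[OF V a] by simp
qed

lemma scaled_form: "c ^ q = c \<Longrightarrow> hermitian_form q \<chi> scale (\<lambda>x y. c * h x y)"
proof unfold_locales
  fix x y assume "c ^ q = c"
  then show "c * h y x = (c * h x y) ^ q"
    using h_conj[of y x] by (simp add: power_mult_distrib)
qed (simp_all add: h_add h_scale algebra_simps)

text \<open>Summing the Gauss sums of all the forms \<open>c * h\<close> with \<open>c\<close> in the fixed field detects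
  the isotropic vectors.\<close>

lemma card_anisotropic:
  assumes "nondegenerate V" "card V = q ^ (2 * Suc k)"
  defines "b \<equiv> - of_nat q :: complex"
  shows "of_nat (card {a \<in> V. h a a \<noteq> 0}) = (b + 1) * b ^ k * (b ^ Suc k - 1)"
proof -
  have fin: "finite V"
    using assms(1) by (simp add: nondegenerate_def)
  have card_V: "(of_nat (card V) :: complex) = b ^ (2 * Suc k)"
    by (simp add: assms(2) b_def power_mult power2_eq_square)
  have scaled: "(\<Sum>x\<in>V. \<chi> (c * h x x)) = b ^ Suc k" if c: "c \<in> fixed_field - {0}" for c
  proof -
    from c interpret c: hermitian_form q \<chi> scale "\<lambda>x y. c * h x y"
      by (intro scaled_form) simp
    have "c.nondegenerate V"
      using assms(1) c by (auto simp: c.nondegenerate_def nondegenerate_def)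
    from c.gauss_sum_nondegenerate[OF this assms(2)] show ?thesis
      by (simp add: c.gauss_sum_def b_def)
  qed
  have "of_nat q * of_nat (card {x \<in> V. h x x = 0}) = (\<Sum>x\<in>V. if h x x = 0 then of_nat q else 0 :: complex)"
    using fin by (simp add: sum.If_cases Int_def)
  also have "\<dots> = (\<Sum>x\<in>V. \<Sum>c\<in>fixed_field. \<chi> (c * h x x))"
    by (intro sum.cong refl) (simp add: card_fixed_field sum_chi_fixed_field h_self_fixed)
  also have "\<dots> = (\<Sum>c\<in>fixed_field. \<Sum>x\<in>V. \<chi> (c * h x x))"
    by (rule sum.swap)
  \<comment> \<open>The term \<open>c = 0\<close> counts all of \<open>V\<close>; each of the other
    \<open>q - 1\<close> scaled forms is again nondegenerate.\<close>
  also have "\<dots> = (\<Sum>x\<in>V. \<chi> (0 * h x x)) + (\<Sum>c\<in>fixed_field - {0}. \<Sum>x\<in>V. \<chi> (c * h x x))"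
    using q_gt_1 by (subst sum.remove[of _ 0]) auto
  also have "\<dots> = of_nat (card V) + of_nat (card (fixed_field - {0})) * b ^ Suc k"
    by (simp add: scaled)
  also have "\<dots> = b ^ (2 * Suc k) - (b + 1) * b ^ Suc k"
    using q_gt_1
    by (simp add: card_V card_fixed_units of_nat_diff) (simp add: b_def algebra_simps)
  finally have iso: "of_nat q * of_nat (card {x \<in> V. h x x = 0}) = b ^ (2 * Suc k) - (b + 1) * b ^ Suc k" .
  have "card V = card ({x \<in> V. h x x = 0} \<union> {x \<in> V. h x x \<noteq> 0})"
    by (rule arg_cong[where f = card]) auto
  also have "\<dots> = card {x \<in> V. h x x = 0} + card {x \<in> V. h x x \<noteq> 0}"
    using fin by (intro card_Un_disjoint) auto
  finally have "(of_nat (card V) :: complex) =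
      of_nat (card {x \<in> V. h x x = 0}) + of_nat (card {x \<in> V. h x x \<noteq> 0})"
    by simp
  moreover have "of_nat q = - b"
    by (simp add: b_def)
  ultimately have "- b * of_nat (card {x \<in> V. h x x \<noteq> 0}) =
      - b * b ^ (2 * Suc k) - (b ^ (2 * Suc k) - (b + 1) * b ^ Suc k)"
    using iso card_V by (simp add: algebra_simps)
  also have "\<dots> = - b * ((b + 1) * b ^ k * (b ^ Suc k - 1))"
    by (simp add: algebra_simps mult_2_right power_add)
  finally have "- b * of_nat (card {x \<in> V. h x x \<noteq> 0}) = \<dots>" .
  then show ?thesis
    using q_gt_1 by (simp add: b_def)
qed

section \<open>Lists of vectors with trivial annihilator\<close>

definition ann :: "'b set \<Rightarrow> 'b set \<Rightarrow> 'b set" where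
  "ann V S = {a \<in> V. \<forall>x\<in>S. h x a = 0}"

definition vlists :: "nat \<Rightarrow> 'b set \<Rightarrow> 'b list set" where
  "vlists m V = {xs. set xs \<subseteq> V \<and> length xs = m}"

definition chi_list :: "'b list \<Rightarrow> complex" where
  "chi_list xs = \<chi> (\<Sum>x\<leftarrow>xs. h x x)"

text \<open>For nondegenerate \<open>V\<close>, a list of its vectors spans \<open>V\<close> exactly
  when its annihilator is \<open>{0}\<close>. In this form, adding a vector intersects the
  annihilator with a hyperplane.\<close>

definition frame_sum :: "nat \<Rightarrow> 'b set \<Rightarrow> complex" where
  "frame_sum m V = (\<Sum>xs\<in>{xs \<in> vlists m V. ann V (set xs) = {0}}. chi_list xs)"

lemma finite_vlists [simp]: "finite V \<Longrightarrow> finite (vlists m V)"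
  unfolding vlists_def by (rule finite_lists_length_eq)

lemma subspace_ann: "subspace V \<Longrightarrow> subspace (ann V S)"
  unfolding subspace_def ann_def by (auto simp: h_add_right h_scale_right)

lemma card_line: "u \<noteq> 0 \<Longrightarrow> card (range (\<lambda>t. t *s u)) = q ^ 2"
  by (subst card_image) (auto simp: card_field intro!: injI)

lemma line_subset: "subspace W \<Longrightarrow> u \<in> W \<Longrightarrow> range (\<lambda>t. t *s u) \<subseteq> W"
  by (auto intro: subspace_scale)

lemma q2_minus_1_neq_0: "(of_nat q ^ 2 - 1 :: complex) \<noteq> 0"
proof
  assume "(of_nat q ^ 2 - 1 :: complex) = 0"
  then have "of_nat (q ^ 2) = (of_nat 1 :: complex)"
    by simp
  then have "q ^ 2 = 1"
    by (simp only: of_nat_eq_iff)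
  then show False
    using q_gt_1 by simp
qed

text \<open>\<open>W\<close> meets the hyperplane \<open>h s = 0\<close> trivially only if it is zero or a line; each line is
  generated by \<open>q ^ 2 - 1\<close> vectors.\<close>

lemma hyperplane_section_indicator:
  assumes V: "subspace V" "finite V" and W: "subspace W" "W \<subseteq> V"
  shows "(of_bool ({a \<in> W. h s a = 0} = {0}) :: complex) = of_bool (W = {0}) +
    (\<Sum>a\<in>V - {0}. of_bool (W = range (\<lambda>t. t *s a)) * of_bool (h s a \<noteq> 0)) / (of_nat q ^ 2 - 1)"
    (is "?L = _ + ?S / _")
proof -
  have W0: "0 \<in> W"
    using W(1) by (rule subspace_0)
  have self: "a \<in> range (\<lambda>t. t *s a)" for a
    by (rule range_eqI[of _ _ 1]) simp
  \<comment> \<open>The cases are \<open>W\<close> zero, a line, and of dimension at least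
    two.\<close>
  consider "W = {0}" | u where "u \<in> W" "u \<noteq> 0" "W = range (\<lambda>t. t *s u)"
    | u where "u \<in> W" "u \<noteq> 0" "\<And>a. W \<noteq> range (\<lambda>t. t *s a)"
  proof (cases "W = {0}")
    case False
    then obtain u where u: "u \<in> W" "u \<noteq> 0"
      using W0 by blast
    show thesis
    proof (cases "\<exists>a. W = range (\<lambda>t. t *s a)")
      case True
      then obtain a where a: "W = range (\<lambda>t. t *s a)" by blast
      then have "a \<noteq> 0"
        using u by auto
      then show thesis
        using that(2)[of a] self a by blast
    next
      case False
      then show thesis
        using that(3) u by blast
    qed
  qed (rule that(1))
  then show ?thesis
  proof cases
    case 1
    have "?S = 0"
      using self by (intro sum.neutral) (auto simp: 1)
    then show ?thesis
      by (auto simp: 1)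
  next
    case (2 u)
    have hs: "h s a = 0 \<longleftrightarrow> h s u = 0" if "a \<in> W" "a \<noteq> 0" for a
      using that unfolding 2(3) by (auto simp: h_scale_right)
    have line: "W = range (\<lambda>t. t *s a) \<longleftrightarrow> a \<in> W" if "a \<noteq> 0" for a
    proof
      assume "a \<in> W"
      then obtain c where c: "a = c *s u"
        unfolding 2(3) by auto
      then have "t *s u = (t / c) *s a" for t
        using that by auto
      then have "W \<subseteq> range (\<lambda>t. t *s a)"
        unfolding 2(3) by blast
      then show "W = range (\<lambda>t. t *s a)"
        using line_subset[OF W(1) \<open>a \<in> W\<close>] by blast
    qed (use self in auto)
    have "?S = (\<Sum>a\<in>V - {0}. if a \<in> W - {0} then of_bool (h s u \<noteq> 0) else 0)"
    proof (intro sum.cong refl)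
      fix a assume "a \<in> V - {0}"
      then show "of_bool (W = range (\<lambda>t. t *s a)) * of_bool (h s a \<noteq> 0) =
          (if a \<in> W - {0} then of_bool (h s u \<noteq> 0) else 0 :: complex)"
        using line[of a] hs[of a] by auto
    qed
    also have "\<dots> = (\<Sum>a\<in>W - {0}. of_bool (h s u \<noteq> 0))"
      using V(2) W(2) by (intro sum.mono_neutral_cong_right) auto
    also have "\<dots> = of_nat (card (W - {0})) * of_bool (h s u \<noteq> 0)"
      by simp
    also have "card (W - {0}) = q ^ 2 - 1"
      using card_line[OF 2(2)] 2(3) W0 by (simp add: card_Diff_singleton)
    also have "of_nat (q ^ 2 - 1) = (of_nat q ^ 2 - 1 :: complex)"
      using q_gt_1 by (simp add: of_nat_diff)
    finally have S: "?S = (of_nat q ^ 2 - 1) * of_bool (h s u \<noteq> 0)" .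
    have "{a \<in> W. h s a = 0} = {0} \<longleftrightarrow> h s u \<noteq> 0"
    proof
      assume "h s u \<noteq> 0"
      then have "a = 0" if "a \<in> W" "h s a = 0" for a
        using hs[of a] that by blast
      then show "{a \<in> W. h s a = 0} = {0}"
        using W0 by auto
    qed (use 2(1,2) in blast)
    moreover have "W \<noteq> {0}"
      using 2(1,2) by auto
    ultimately show ?thesis
      using q2_minus_1_neq_0 by (simp add: S)
  next
    case (3 u)
    have "?S = 0"
      using 3(3) by (intro sum.neutral) auto
    moreover have "W \<noteq> {0}"
      using 3(1,2) by auto
    moreover have "\<exists>a\<in>W. a \<noteq> 0 \<and> h s a = 0"
    proof (cases "h s u = 0")
      case False
      obtain w where w: "w \<in> W" "w \<notin> range (\<lambda>t. t *s u)"
        using 3(3)[of u] line_subset[OF W(1) 3(1)] by blast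
      \<comment> \<open>Subtracting this multiple of \<open>u\<close> moves \<open>w\<close> into
        the hyperplane; the power \<open>q\<close> undoes the conjugation in the second argument of
        \<open>h\<close>.\<close>
      let ?c = "(h s w / h s u) ^ q"
      have "w - ?c *s u \<in> W"
        using w 3(1) W(1) by (intro subspace_diff subspace_scale)
      moreover have "w - ?c *s u \<noteq> 0"
        using w(2) by auto
      moreover have "h s (w - ?c *s u) = 0"
        using False by (simp add: h_diff_right h_scale_right)
      ultimately show ?thesis by blast
    qed (use 3(1,2) in blast)
    then have "{a \<in> W. h s a = 0} \<noteq> {0}"
      by blast
    ultimately show ?thesis by simp
  qed
qed

text \<open>Shifting \<open>s\<close> by \<open>t *s a\<close> preserves the domain, since
  \<open>a\<close> is isotropic, and changes \<open>h s s\<close> by the trace of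
  \<open>t * h a s\<close>. Averaging over all \<open>t\<close> gives 0 because \<open>h a s\<close>
  is nonzero.\<close>

lemma sum_off_isotropic:
  assumes "subspace V" "a \<in> V" "a \<noteq> 0" "h a a = 0"
  shows "(\<Sum>s\<in>{s \<in> V. h s a \<noteq> 0}. \<chi> (h s s)) = 0"
proof -
  let ?A = "{s \<in> V. h s a \<noteq> 0}"
  have shift: "(\<Sum>s\<in>?A. \<chi> (h s s)) = (\<Sum>s\<in>?A. \<chi> (h (s + t *s a) (s + t *s a)))" for t
    by (rule sum.reindex_bij_witness[of _ "\<lambda>s. s + t *s a" "\<lambda>s. s - t *s a"])
      (use assms in \<open>auto simp: h_add h_diff h_scale intro: subspace_add subspace_diff subspace_scale\<close>)
  have expand: "h (s + t *s a) (s + t *s a) = h s s + (t * h a s + (t * h a s) ^ q)" for s t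
    using assms(4) h_conj[of s a]
    by (simp add: h_add h_add_right h_scale h_scale_right power_mult_distrib add_ac)
  have "of_nat (q ^ 2) * (\<Sum>s\<in>?A. \<chi> (h s s)) = (\<Sum>t\<in>(UNIV :: 'a set). \<Sum>s\<in>?A. \<chi> (h s s))"
    by (simp add: card_field)
  also have "\<dots> = (\<Sum>t\<in>UNIV. \<Sum>s\<in>?A. \<chi> (h s s) * \<chi> (t * h a s + (t * h a s) ^ q))"
  proof (rule sum.cong[OF refl])
    fix t
    show "(\<Sum>s\<in>?A. \<chi> (h s s)) = (\<Sum>s\<in>?A. \<chi> (h s s) * \<chi> (t * h a s + (t * h a s) ^ q))"
      unfolding shift[of t] expand chi_add[of "h s s" for s] ..
  qed
  also have "\<dots> = (\<Sum>s\<in>?A. \<Sum>t\<in>UNIV. \<chi> (h s s) * \<chi> (t * h a s + (t * h a s) ^ q))"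
    by (rule sum.swap)
  also have "\<dots> = 0"
    using h_eq_0_commute[of _ a]
    by (intro sum.neutral[of ?A] ballI) (simp add: sum_chi_trace flip: sum_distrib_left)
  finally show ?thesis
    using q_gt_1 by simp
qed

lemma sum_off_anisotropic:
  assumes "finite V"
  shows "(\<Sum>s\<in>{s \<in> V. h s a \<noteq> 0}. \<chi> (h s s)) = gauss_sum V - gauss_sum (perp V a)"
proof -
  have "V = perp V a \<union> {s \<in> V. h s a \<noteq> 0}"
    by (auto simp: perp_def)
  then have "gauss_sum V = (\<Sum>s\<in>perp V a \<union> {s \<in> V. h s a \<noteq> 0}. \<chi> (h s s))"
    by (simp add: gauss_sum_def)
  also have "\<dots> = gauss_sum (perp V a) + (\<Sum>s\<in>{s \<in> V. h s a \<noteq> 0}. \<chi> (h s s))"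
    unfolding gauss_sum_def using assms
    by (intro sum.union_disjoint) (auto simp: perp_def)
  finally show ?thesis by simp
qed

text \<open>Being annihilated by \<open>a\<close> means lying in \<open>perp V a\<close>, and the
  line of \<open>a\<close> splits off from the annihilator. Lists that fall short of
  \<open>V\<close> by one anisotropic direction thus become the lists of
  \<open>frame_sum m (perp V a)\<close>, which lets the induction descend.\<close>

lemma ann_line_iff_frame:
  assumes "subspace V" "a \<in> V" "h a a \<noteq> 0"
  shows "{xs \<in> vlists m V. ann V (set xs) = range (\<lambda>t. t *s a)} =
    {xs \<in> vlists m (perp V a). ann (perp V a) (set xs) = {0}}"
proof (intro Set.set_eqI iffI)
  fix xs assume "xs \<in> {xs \<in> vlists m V. ann V (set xs) = range (\<lambda>t. t *s a)}"
  then have xs: "xs \<in> vlists m V" and ann: "ann V (set xs) = range (\<lambda>t. t *s a)"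
    by auto
  have "a \<in> ann V (set xs)"
    unfolding ann by (rule range_eqI[of _ _ 1]) simp
  then have "xs \<in> vlists m (perp V a)"
    using xs by (auto simp: vlists_def perp_def ann_def)
  moreover have "y = 0" if y: "y \<in> ann (perp V a) (set xs)" for y
  proof -
    have "y \<in> ann V (set xs)" "h y a = 0"
      using y by (auto simp: ann_def perp_def)
    then show ?thesis
      using assms(3) unfolding ann by (auto simp: h_scale)
  qed
  then have "ann (perp V a) (set xs) = {0}"
    using subspace_0[OF subspace_ann[OF subspace_perp[OF assms(1)]]] by blast
  ultimately show "xs \<in> {xs \<in> vlists m (perp V a). ann (perp V a) (set xs) = {0}}"
    by simp
next
  fix xs assume "xs \<in> {xs \<in> vlists m (perp V a). ann (perp V a) (set xs) = {0}}"
  then have xs: "xs \<in> vlists m (perp V a)" and ann: "ann (perp V a) (set xs) = {0}"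
    by auto
  have hx: "h x a = 0" if "x \<in> set xs" for x
    using xs that by (auto simp: vlists_def perp_def)
  have "xs \<in> vlists m V"
    using xs by (auto simp: vlists_def perp_def)
  moreover have "ann V (set xs) = range (\<lambda>t. t *s a)"
  proof
    show "range (\<lambda>t. t *s a) \<subseteq> ann V (set xs)"
      using assms(1,2) hx by (auto simp: ann_def h_scale_right intro: subspace_scale)
    show "ann V (set xs) \<subseteq> range (\<lambda>t. t *s a)"
    proof
      fix v assume v: "v \<in> ann V (set xs)"
      then have "v \<in> V"
        by (simp add: ann_def)
      from perp_decompose[OF assms this] obtain t y where y: "y \<in> perp V a" and v': "v = t *s a + y"
        by blast
      have "y \<in> ann (perp V a) (set xs)"
        using v y hx by (auto simp: ann_def v' h_add_right h_scale_right)
      then have "v = t *s a"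
        using ann v' by simp
      then show "v \<in> range (\<lambda>t. t *s a)"
        by (rule range_eqI)
    qed
  qed
  ultimately show "xs \<in> {xs \<in> vlists m V. ann V (set xs) = range (\<lambda>t. t *s a)}"
    by simp
qed

text \<open>Split off the head \<open>s\<close>. The annihilator of \<open>s # xs\<close> is trivial
  if that of \<open>xs\<close> is, or if that of \<open>xs\<close> is a line not orthogonal to
  \<open>s\<close>; division by \<open>q ^ 2 - 1\<close> accounts for the generators of the
  line.\<close>

lemma frame_sum_Suc:
  assumes V: "subspace V" "finite V"
  shows "frame_sum (Suc m) V = gauss_sum V * frame_sum m V +
    (\<Sum>a\<in>V - {0}. (\<Sum>s\<in>{s \<in> V. h s a \<noteq> 0}. \<chi> (h s s)) *
      (\<Sum>xs\<in>{xs \<in> vlists m V. ann V (set xs) = range (\<lambda>t. t *s a)}. chi_list xs)) / (of_nat q ^ 2 - 1)"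
    (is "_ = _ + (\<Sum>a\<in>_. ?E a * ?B a) / ?d")
proof -
  let ?z = "\<lambda>xs. of_bool (ann V (set xs) = {0}) :: complex"
  let ?l = "\<lambda>a xs. of_bool (ann V (set xs) = range (\<lambda>t. t *s a)) :: complex"
  let ?n = "\<lambda>a s. of_bool (h s a \<noteq> 0) :: complex"
  have restrict: "(\<Sum>x\<in>{x \<in> A. P x}. f x) = (\<Sum>x\<in>A. of_bool (P x) * f x)" if "finite A"
    for A :: "'c set" and P and f :: "'c \<Rightarrow> complex"
    using that by (simp add: sum_of_bool_mult_eq Int_def)
  have expand: "(z + (\<Sum>a\<in>A. l a * n a) / d) * (x * c) = x * (z * c) + (\<Sum>a\<in>A. (n a * x) * (l a * c)) / d"
    for z d x c :: complex and l n and A :: "'b set"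
    by (simp add: algebra_simps sum_distrib_left sum_divide_distrib)
  have bij: "bij_betw (\<lambda>(s, xs). s # xs) (V \<times> vlists m V) (vlists (Suc m) V)"
    by (rule bij_betw_byWitness[where f' = "\<lambda>xs. (hd xs, tl xs)"])
      (auto simp: vlists_def length_Suc_conv)
  have frame: "frame_sum m V = (\<Sum>xs\<in>vlists m V. ?z xs * chi_list xs)" for m
    unfolding frame_sum_def using V(2) by (simp add: restrict)
  have "frame_sum (Suc m) V = (\<Sum>s\<in>V. \<Sum>xs\<in>vlists m V. ?z (s # xs) * chi_list (s # xs))"
    unfolding frame using sum.reindex_bij_betw[OF bij, of "\<lambda>xs. ?z xs * chi_list xs"]
    by (simp add: sum.cartesian_product case_prod_unfold)
  also have "\<dots> = (\<Sum>s\<in>V. \<Sum>xs\<in>vlists m V. \<chi> (h s s) * (?z xs * chi_list xs) +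
      (\<Sum>a\<in>V - {0}. (?n a s * \<chi> (h s s)) * (?l a xs * chi_list xs)) / ?d)"
  proof (intro sum.cong refl)
    fix s xs
    have "ann V (set (s # xs)) = {a \<in> ann V (set xs). h s a = 0}"
      by (auto simp: ann_def)
    then have z: "?z (s # xs) = ?z xs + (\<Sum>a\<in>V - {0}. ?l a xs * ?n a s) / ?d"
      using hyperplane_section_indicator[OF V subspace_ann[OF V(1)], of "set xs" s]
      by (simp add: ann_def)
    have c: "chi_list (s # xs) = \<chi> (h s s) * chi_list xs"
      by (simp add: chi_list_def chi_add)
    show "?z (s # xs) * chi_list (s # xs) = \<chi> (h s s) * (?z xs * chi_list xs) +
      (\<Sum>a\<in>V - {0}. (?n a s * \<chi> (h s s)) * (?l a xs * chi_list xs)) / ?d"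
      unfolding z c by (rule expand)
  qed
  also have "\<dots> = (\<Sum>s\<in>V. \<Sum>xs\<in>vlists m V. \<chi> (h s s) * (?z xs * chi_list xs)) +
      (\<Sum>s\<in>V. \<Sum>xs\<in>vlists m V. \<Sum>a\<in>V - {0}. (?n a s * \<chi> (h s s)) * (?l a xs * chi_list xs)) / ?d"
    by (simp only: sum.distrib sum_divide_distrib)
  also have "(\<Sum>s\<in>V. \<Sum>xs\<in>vlists m V. \<chi> (h s s) * (?z xs * chi_list xs)) = gauss_sum V * frame_sum m V"
    unfolding gauss_sum_def frame sum_product ..
  also have "(\<Sum>s\<in>V. \<Sum>xs\<in>vlists m V. \<Sum>a\<in>V - {0}. (?n a s * \<chi> (h s s)) * (?l a xs * chi_list xs)) =
      (\<Sum>s\<in>V. \<Sum>a\<in>V - {0}. \<Sum>xs\<in>vlists m V. (?n a s * \<chi> (h s s)) * (?l a xs * chi_list xs))"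
    by (intro sum.cong refl sum.swap)
  also have "\<dots> = (\<Sum>a\<in>V - {0}. \<Sum>s\<in>V. \<Sum>xs\<in>vlists m V. (?n a s * \<chi> (h s s)) * (?l a xs * chi_list xs))"
    by (rule sum.swap)
  also have "\<dots> = (\<Sum>a\<in>V - {0}. ?E a * ?B a)"
    by (simp only: restrict[OF V(2)] restrict[OF finite_vlists[OF V(2)]] sum_product)
  finally show ?thesis .
qed

text \<open>The factor at index 0 is \<open>b ^ Suc m - 1\<close>; each later factor on the left is
  \<open>b ^ 2\<close> times the preceding-index factor for \<open>m\<close>.\<close>

lemma frame_prod_Suc:
  fixes b :: complex
  shows "(\<Prod>i<Suc k. b ^ (Suc m + i) - b ^ (2 * i)) =
    (b ^ Suc m - 1) * b ^ (2 * k) * (\<Prod>i<k. b ^ (m + i) - b ^ (2 * i))"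
proof -
  have "(\<Prod>i<Suc k. b ^ (Suc m + i) - b ^ (2 * i)) =
      (b ^ Suc m - 1) * (\<Prod>i<k. b ^ (Suc m + Suc i) - b ^ (2 * Suc i))"
    by (subst prod.lessThan_Suc_shift) simp
  also have "(\<Prod>i<k. b ^ (Suc m + Suc i) - b ^ (2 * Suc i)) =
      (\<Prod>i<k. b ^ 2 * (b ^ (m + i) - b ^ (2 * i)))"
    by (intro prod.cong refl) (simp add: algebra_simps power2_eq_square)
  also have "\<dots> = b ^ (2 * k) * (\<Prod>i<k. b ^ (m + i) - b ^ (2 * i))"
    by (simp add: prod.distrib power_mult)
  finally show ?thesis by simp
qed

theorem frame_sum_nondegenerate:
  assumes "nondegenerate V" "card V = q ^ (2 * k)"
  defines "b \<equiv> - of_nat q :: complex"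
  shows "frame_sum m V = (\<Prod>i<k. b ^ (m + i) - b ^ (2 * i))"
  using assms(1,2)
\<comment> \<open>The space and its dimension vary because the step also uses the spaces
  \<open>perp V a\<close>.\<close>
proof (induction m arbitrary: V k)
  case 0
  then have V: "subspace V"
    by (simp add: nondegenerate_def)
  have "{xs \<in> vlists 0 V. ann V (set xs) = {0}} = (if V = {0} then {[]} else {})"
    by (auto simp: vlists_def ann_def)
  then have frame: "frame_sum 0 V = of_bool (V = {0})"
    unfolding frame_sum_def by (simp only:) (simp add: chi_list_def)
  show ?case
  proof (cases k)
    case 0
    then have "V = {0}"
      using "0.prems" subspace_0[OF V] by (auto simp: card_1_singleton_iff)
    then show ?thesis
      using frame by (simp add: 0)
  next
    case (Suc j)
    have "1 < q ^ (2 * k)"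
      using q_gt_1 Suc by (intro one_less_power) auto
    then have "V \<noteq> {0}"
      using "0.prems"(2) by auto
    \<comment> \<open>The factor at index 0 is \<open>b ^ 0 - b ^ 0\<close>, matching the fact that
      the empty list does not span a nonzero space.\<close>
    moreover have "(\<Prod>i<k. b ^ (0 + i) - b ^ (2 * i)) = 0"
      using Suc by (intro prod_zero bexI[of _ 0]) auto
    ultimately show ?thesis
      by (simp add: frame)
  qed
next
  case (Suc m)
  then have V: "subspace V" "finite V"
    by (simp_all add: nondegenerate_def)
  let ?P = "\<lambda>m k. \<Prod>i<k. b ^ (m + i) - b ^ (2 * i)"
  let ?B = "\<lambda>a. \<Sum>xs\<in>{xs \<in> vlists m V. ann V (set xs) = range (\<lambda>t. t *s a)}. chi_list xs"
  let ?E = "\<lambda>a. \<Sum>s\<in>{s \<in> V. h s a \<noteq> 0}. \<chi> (h s s)"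
  have step: "frame_sum (Suc m) V = b ^ k * ?P m k + (\<Sum>a\<in>V - {0}. ?E a * ?B a) / (of_nat q ^ 2 - 1)"
    unfolding frame_sum_Suc[OF V] Suc.IH[OF Suc.prems]
    using gauss_sum_nondegenerate[OF Suc.prems] by (simp add: b_def)
  show ?case
  proof (cases k)
    case 0
    then have "V = {0}"
      using Suc.prems subspace_0[OF V(1)] by (auto simp: card_1_singleton_iff)
    then show ?thesis
      using step by (simp add: 0)
  next
    case (Suc j)
    let ?A = "{a \<in> V. h a a \<noteq> 0}"
    \<comment> \<open>Both identities are used with \<open>x = b ^ j\<close> and \<open>P\<close>
      the product \<open>?P m j\<close>; in \<open>alg2\<close>, \<open>y\<close> is
      \<open>b ^ m\<close>.\<close>
    have alg1: "(b + 1) * x * (b * x - 1) * ((b * x - x) * P) = ((b + 1) * (b - 1)) * (x * x * (b * x - 1) * P)"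
      for x P by (simp add: algebra_simps)
    have alg2: "b * x * (P * (y * x - x * x)) + x * x * (b * x - 1) * P = (b * y - 1) * (x * x) * P"
      for x y P by (simp add: algebra_simps)
    have EB: "?E a * ?B a = (b ^ Suc j - b ^ j) * ?P m j" if "a \<in> ?A" for a
    proof -
      have a: "a \<in> V" "h a a \<noteq> 0"
        using that by auto
      note nd = nondegenerate_perp[OF Suc.prems(1) a]
      have "q ^ 2 * card (perp V a) = q ^ 2 * q ^ (2 * j)"
        using card_perp[OF V(1) a] Suc.prems(2) by (simp add: Suc flip: power_add)
      then have card: "card (perp V a) = q ^ (2 * j)"
        using q_gt_1 by simp
      have "?E a = b ^ Suc j - b ^ j"
        using gauss_sum_nondegenerate[OF Suc.prems] gauss_sum_nondegenerate[OF nd card]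
        by (simp add: sum_off_anisotropic[OF V(2)] Suc b_def)
      moreover have "?B a = ?P m j"
        unfolding ann_line_iff_frame[OF V(1) a] using Suc.IH[OF nd card]
        by (simp add: frame_sum_def)
      ultimately show ?thesis by simp
    qed
    \<comment> \<open>Isotropic \<open>a\<close> drop out by \<open>sum_off_isotropic\<close>; the
      anisotropic ones all contribute the same amount.\<close>
    have "(\<Sum>a\<in>V - {0}. ?E a * ?B a) = (\<Sum>a\<in>?A. ?E a * ?B a)"
      using V sum_off_isotropic[OF V(1)] by (intro sum.mono_neutral_right) auto
    also have "\<dots> = of_nat (card ?A) * ((b ^ Suc j - b ^ j) * ?P m j)"
      by (simp add: EB)
    also have "\<dots> = (b + 1) * b ^ j * (b ^ Suc j - 1) * ((b ^ Suc j - b ^ j) * ?P m j)"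
      using card_anisotropic[OF Suc.prems(1)[folded Suc], of j, folded b_def] Suc.prems(2) Suc
      by (simp only: )
    also have "\<dots> = ((b + 1) * (b - 1)) * (b ^ (2 * j) * (b ^ Suc j - 1) * ?P m j)"
      unfolding mult_2 power_add power_Suc by (rule alg1)
    also have "(b + 1) * (b - 1) = of_nat q ^ 2 - 1"
      by (simp add: b_def power2_eq_square algebra_simps)
    finally have "(\<Sum>a\<in>V - {0}. ?E a * ?B a) / (of_nat q ^ 2 - 1) = b ^ (2 * j) * (b ^ Suc j - 1) * ?P m j"
      using q2_minus_1_neq_0 by simp
    then have "frame_sum (Suc m) V = b ^ k * ?P m k + b ^ (2 * j) * (b ^ Suc j - 1) * ?P m j"
      unfolding step by simp
    also have "\<dots> = (b ^ Suc m - 1) * b ^ (2 * j) * ?P m j"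
      unfolding Suc prod.lessThan_Suc mult_2 power_add power_Suc by (rule alg2)
    also have "\<dots> = ?P (Suc m) k"
      unfolding Suc frame_prod_Suc ..
    finally show ?thesis .
  qed
qed

end

section \<open>Matrices of full rank as lists of rows\<close>

text \<open>Vectors of length \<open>k\<close> are padded with zeros, so that all lengths share one
  type and shortening is \<open>trunc\<close>.\<close>

definition coord_space :: "nat \<Rightarrow> (nat \<Rightarrow> 'a :: field) set" where
  "coord_space k = {x. \<forall>i\<ge>k. x i = 0}"

definition dot :: "nat \<Rightarrow> (nat \<Rightarrow> 'a) \<Rightarrow> (nat \<Rightarrow> 'a) \<Rightarrow> 'a :: field" where
  "dot k x a = (\<Sum>i<k. x i * a i)"

definition trunc :: "nat \<Rightarrow> (nat \<Rightarrow> 'a) \<Rightarrow> nat \<Rightarrow> 'a :: field" where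
  "trunc k x = (\<lambda>i. if i < k then x i else 0)"

text \<open>Row lists of the \<open>m \<times> k\<close> matrices of rank \<open>k\<close>.\<close>

definition full_rank_rows :: "nat \<Rightarrow> nat \<Rightarrow> (nat \<Rightarrow> 'a :: field) list set" where
  "full_rank_rows m k = {xs. set xs \<subseteq> coord_space k \<and> length xs = m \<and>
     (\<forall>a\<in>coord_space k. (\<forall>x\<in>set xs. dot k x a = 0) \<longrightarrow> a = 0)}"

lemma coord_space_0: "coord_space 0 = {0}"
  by (auto simp: coord_space_def)

lemma bij_betw_coord_space_Suc:
  "bij_betw (\<lambda>(x, c). x(k := c)) (coord_space k \<times> UNIV) (coord_space (Suc k) :: (nat \<Rightarrow> 'a :: field) set)"
  by (rule bij_betw_byWitness[where f' = "\<lambda>z. (trunc k z, z k)"])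
    (auto simp: coord_space_def trunc_def fun_eq_iff not_less_eq_eq intro: le_neq_implies_less)

lemma card_coord_space: "card (coord_space k :: (nat \<Rightarrow> 'a :: {field, finite}) set) = CARD('a) ^ k"
proof (induction k)
  case (Suc k)
  then show ?case
    using bij_betw_same_card[OF bij_betw_coord_space_Suc[of k, where 'a = 'a]]
    by (simp add: card_cartesian_product mult.commute)
qed (simp add: coord_space_0)

lemma finite_coord_space [simp]: "finite (coord_space k :: (nat \<Rightarrow> 'a :: {field, finite}) set)"
  by (rule card_ge_0_finite) (simp add: card_coord_space finite_UNIV_card_ge_0)

lemma trunc_coord_space [simp]: "trunc k x \<in> coord_space k"
  by (simp add: trunc_def coord_space_def)

lemma trunc_id: "x \<in> coord_space k \<Longrightarrow> trunc k x = x"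
  by (auto simp: trunc_def coord_space_def)

lemma dot_trunc [simp]: "dot k (trunc k x) a = dot k x a"
  by (simp add: dot_def trunc_def)

lemma dot_Suc: "dot (Suc k) x a = dot k x a + x k * a k"
  by (simp add: dot_def)

lemma dot_upd [simp]: "dot k x (a(k := c)) = dot k x a"
  by (simp add: dot_def)

lemma dot_diff_right: "dot k x (a - b) = dot k x a - dot k x b"
  by (simp add: dot_def right_diff_distrib sum_subtractf)

lemma coord_space_diff: "a \<in> coord_space k \<Longrightarrow> b \<in> coord_space k \<Longrightarrow> a - b \<in> coord_space k"
  by (simp add: coord_space_def)

lemma finite_full_rank_rows [simp]:
  "finite (full_rank_rows m k :: (nat \<Rightarrow> 'a :: {field, finite}) list set)"
  by (rule finite_subset[OF _ finite_lists_length_eq[OF finite_coord_space[of k], of m]])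
    (auto simp: full_rank_rows_def)

text \<open>The image of \<open>coord_space k\<close> is the span of the first \<open>k\<close>
  columns: the entries \<open>dot k x a\<close> form the combination of these columns with
  coefficients \<open>a\<close>. So the last column has to lie outside that span.\<close>

lemma full_rank_rows_Suc_iff:
  assumes zs: "set zs \<subseteq> coord_space (Suc k)" "length zs = m"
  shows "zs \<in> full_rank_rows m (Suc k) \<longleftrightarrow> map (trunc k) zs \<in> full_rank_rows m k \<and>
    map (\<lambda>z. z k) zs \<notin> (\<lambda>a. map (\<lambda>x. dot k x a) (map (trunc k) zs)) ` coord_space k"
    (is "_ \<longleftrightarrow> ?A \<and> ?B")
proof
  assume L: "zs \<in> full_rank_rows m (Suc k)"
  have ?A
    unfolding full_rank_rows_def
  proof (intro CollectI conjI ballI impI)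
    fix a assume a: "a \<in> coord_space k" "\<forall>x\<in>set (map (trunc k) zs). dot k x a = 0"
    then have "a \<in> coord_space (Suc k)" "\<forall>z\<in>set zs. dot (Suc k) z a = 0"
      by (auto simp: coord_space_def dot_Suc)
    then show "a = 0"
      using L by (auto simp: full_rank_rows_def)
  qed (use zs in auto)
  moreover have ?B
  proof
    assume "map (\<lambda>z. z k) zs \<in> (\<lambda>a. map (\<lambda>x. dot k x a) (map (trunc k) zs)) ` coord_space k"
    then obtain a where a: "a \<in> coord_space k" "\<forall>z\<in>set zs. z k = dot k z a"
      by auto
    \<comment> \<open>If the last column is the combination \<open>a\<close> of the others, this is
      a kernel vector.\<close>
    then have "a(k := - 1) \<in> coord_space (Suc k)" "\<forall>z\<in>set zs. dot (Suc k) z (a(k := - 1)) = 0"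
      by (auto simp: coord_space_def dot_Suc)
    then have "a(k := - 1) = 0"
      using L unfolding full_rank_rows_def by blast
    then have "(a(k := - 1)) k = 0"
      by simp
    then show False by simp
  qed
  ultimately show "?A \<and> ?B" ..
next
  assume AB: "?A \<and> ?B"
  show "zs \<in> full_rank_rows m (Suc k)"
    unfolding full_rank_rows_def
  proof (intro CollectI conjI ballI impI)
    fix a assume a: "a \<in> coord_space (Suc k)" "\<forall>x\<in>set zs. dot (Suc k) x a = 0"
    show "a = 0"
    proof (cases "a k = 0")
      case True
      have "a i = 0" if "i \<ge> k" for i
        using that a(1) True by (cases "i = k") (auto simp: coord_space_def)
      then have "a \<in> coord_space k"
        by (simp add: coord_space_def)
      moreover have "\<forall>x\<in>set (map (trunc k) zs). dot k x a = 0"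
        using a(2) True by (simp add: dot_Suc)
      ultimately show ?thesis
        using AB by (simp add: full_rank_rows_def)
    next
      case False
      \<comment> \<open>Scaling a kernel vector to last entry \<open>- 1\<close> expresses the last
        column by the others.\<close>
      let ?a = "trunc k (\<lambda>i. - a i / a k)"
      have "z k = dot k z ?a" if "z \<in> set zs" for z
      proof -
        have "dot k z ?a = - dot k z a / a k"
          by (simp add: dot_def trunc_def sum_divide_distrib sum_negf)
        also have "\<dots> = z k"
        proof -
          have "- dot k z a = z k * a k"
            using a(2) that by (simp add: dot_Suc add_eq_0_iff)
          then show ?thesis
            using False by simp
        qed
        finally show ?thesis ..
      qed
      then have "map (\<lambda>z. z k) zs = map (\<lambda>x. dot k x ?a) (map (trunc k) zs)"
        by simp
      then show ?thesis
        using AB trunc_coord_space by blast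
    qed
  qed (use zs in auto)
qed

text \<open>A full rank matrix \<open>xs\<close> is extended by the columns outside its column
  space. That space has \<open>Q ^ k\<close> elements by injectivity, so each value
  \<open>f xs\<close> occurs \<open>Q ^ m - Q ^ k\<close> times.\<close>

lemma sum_full_rank_rows_Suc:
  fixes f :: "(nat \<Rightarrow> 'a :: {field, finite}) list \<Rightarrow> complex"
  defines "Q \<equiv> of_nat CARD('a) :: complex"
  shows "(\<Sum>zs\<in>full_rank_rows m (Suc k). f (map (trunc k) zs)) =
    (Q ^ m - Q ^ k) * (\<Sum>xs\<in>full_rank_rows m k. f xs)"
proof -
  let ?I = "\<lambda>xs. (\<lambda>a. map (\<lambda>x. dot k x a) xs) ` coord_space k :: 'a list set"
  let ?C = "\<lambda>xs. {cs. length cs = m} - ?I xs"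
  \<comment> \<open>\<open>?j\<close> appends a column to a list of rows, and \<open>?r\<close>
    splits it off again.\<close>
  let ?j = "\<lambda>(xs :: (nat \<Rightarrow> 'a) list, cs). map2 (\<lambda>x c. x(k := c)) xs cs"
  let ?r = "\<lambda>zs :: (nat \<Rightarrow> 'a) list. (map (trunc k) zs, map (\<lambda>z. z k) zs)"
  have rj: "?r (?j (xs, cs)) = (xs, cs)" if "set xs \<subseteq> coord_space k" "length xs = m" "length cs = m" for xs cs
  proof -
    have "map (trunc k) (map2 (\<lambda>x c. x(k := c)) xs cs) = xs"
    proof (rule nth_equalityI)
      fix i assume "i < length (map (trunc k) (map2 (\<lambda>x c. x(k := c)) xs cs))"
      then have "i < length xs" "i < length cs" "xs ! i \<in> coord_space k"
        using that by auto
      then show "map (trunc k) (map2 (\<lambda>x c. x(k := c)) xs cs) ! i = xs ! i"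
        by (auto simp: trunc_def coord_space_def)
    qed (use that in simp)
    moreover have "map (\<lambda>z. z k) (map2 (\<lambda>x c. x(k := c)) xs cs) = cs"
      using that by (intro nth_equalityI) auto
    ultimately show ?thesis by simp
  qed
  have jr: "?j (?r zs) = zs" if "set zs \<subseteq> coord_space (Suc k)" for zs
  proof -
    have "(trunc k z)(k := z k) = z" if "z \<in> coord_space (Suc k)" for z :: "nat \<Rightarrow> 'a"
      using that by (auto simp: trunc_def coord_space_def fun_eq_iff not_less_eq_eq)
    then show ?thesis
      using that by (induction zs) auto
  qed
  have j_sub: "set (?j (xs, cs)) \<subseteq> coord_space (Suc k)" if "set xs \<subseteq> coord_space k" for xs cs
    using that by (auto simp: coord_space_def dest!: set_zip_leftD)
  have bij: "bij_betw ?j (Sigma (full_rank_rows m k) ?C) (full_rank_rows m (Suc k))"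
  proof (rule bij_betw_byWitness[where f' = ?r])
    show "\<forall>p\<in>Sigma (full_rank_rows m k) ?C. ?r (?j p) = p"
      using rj by (auto simp: full_rank_rows_def)
    show "\<forall>zs\<in>full_rank_rows m (Suc k). ?j (?r zs) = zs"
      using jr by (auto simp: full_rank_rows_def)
    show "?r ` full_rank_rows m (Suc k) \<subseteq> Sigma (full_rank_rows m k) ?C"
    proof
      fix p assume "p \<in> ?r ` full_rank_rows m (Suc k)"
      then obtain zs where zs: "zs \<in> full_rank_rows m (Suc k)" and p: "p = ?r zs" by blast
      then have "set zs \<subseteq> coord_space (Suc k)" "length zs = m"
        by (auto simp: full_rank_rows_def)
      then show "p \<in> Sigma (full_rank_rows m k) ?C"
        using full_rank_rows_Suc_iff zs unfolding p by auto
    qed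
    show "?j ` Sigma (full_rank_rows m k) ?C \<subseteq> full_rank_rows m (Suc k)"
    proof
      fix zs assume "zs \<in> ?j ` Sigma (full_rank_rows m k) ?C"
      then obtain xs cs where xs: "xs \<in> full_rank_rows m k" "cs \<in> ?C xs" and z: "zs = ?j (xs, cs)"
        by blast
      then have *: "set xs \<subseteq> coord_space k" "length xs = m" "length cs = m"
        by (auto simp: full_rank_rows_def)
      have "map (trunc k) zs = xs" "map (\<lambda>z. z k) zs = cs"
        using rj[OF *] unfolding z by simp_all
      then show "zs \<in> full_rank_rows m (Suc k)"
        using full_rank_rows_Suc_iff[of zs k m] j_sub[OF *(1), of cs] * xs unfolding z by simp
    qed
  qed
  have card: "of_nat (card (?C xs)) = Q ^ m - Q ^ k" if xs: "xs \<in> full_rank_rows m k" for xs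
  proof -
    have "inj_on (\<lambda>a. map (\<lambda>x. dot k x a) xs) (coord_space k)"
    proof (rule inj_onI)
      fix a b :: "nat \<Rightarrow> 'a"
      assume ab: "a \<in> coord_space k" "b \<in> coord_space k" "map (\<lambda>x. dot k x a) xs = map (\<lambda>x. dot k x b) xs"
      then have "\<forall>x\<in>set xs. dot k x (a - b) = 0"
        by (simp add: dot_diff_right)
      then have "a - b = 0"
        using xs coord_space_diff[OF ab(1,2)] unfolding full_rank_rows_def by blast
      then show "a = b" by simp
    qed
    then have I: "card (?I xs) = CARD('a) ^ k"
      by (simp add: card_image card_coord_space)
    have fin: "finite {cs :: 'a list. length cs = m}" and A: "card {cs :: 'a list. length cs = m} = CARD('a) ^ m"
      using finite_lists_length_eq[of "UNIV :: 'a set" m] card_lists_length_eq[of "UNIV :: 'a set" m] by simp_all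
    have sub: "?I xs \<subseteq> {cs. length cs = m}"
      using xs by (auto simp: full_rank_rows_def)
    have "card (?C xs) = CARD('a) ^ m - CARD('a) ^ k"
      using card_Diff_subset[OF finite_subset[OF sub fin] sub] I A by simp
    moreover have "CARD('a) ^ k \<le> CARD('a) ^ m"
      using card_mono[OF fin sub] I A by simp
    ultimately show ?thesis
      by (simp add: of_nat_diff Q_def)
  qed
  have "(\<Sum>zs\<in>full_rank_rows m (Suc k). f (map (trunc k) zs)) =
      (\<Sum>p\<in>Sigma (full_rank_rows m k) ?C. f (map (trunc k) (?j p)))"
    by (rule sum.reindex_bij_betw[OF bij, symmetric])
  also have "\<dots> = (\<Sum>p\<in>Sigma (full_rank_rows m k) ?C. f (fst p))"
    using rj by (intro sum.cong refl arg_cong[where f = f]) (auto simp: full_rank_rows_def)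
  also have "\<dots> = (\<Sum>xs\<in>full_rank_rows m k. \<Sum>cs\<in>?C xs. f xs)"
    using finite_lists_length_eq[of "UNIV :: 'a set" m]
    by (subst sum.Sigma) (auto simp: case_prod_unfold)
  also have "\<dots> = (\<Sum>xs\<in>full_rank_rows m k. (Q ^ m - Q ^ k) * f xs)"
    using card by (intro sum.cong refl) simp
  finally show ?thesis
    by (simp add: sum_distrib_left)
qed

text \<open>For summands that see only the first \<open>k\<close> coordinates, such as the form of a
  rank \<open>k\<close> matrix after a change of basis, the remaining columns merely contribute a
  factor.\<close>

lemma sum_full_rank_rows:
  fixes f :: "(nat \<Rightarrow> 'a :: {field, finite}) list \<Rightarrow> complex"
  assumes "k \<le> n"
  defines "Q \<equiv> of_nat CARD('a) :: complex"
  shows "(\<Sum>zs\<in>full_rank_rows m n. f (map (trunc k) zs)) =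
    (\<Prod>i=k..<n. Q ^ m - Q ^ i) * (\<Sum>xs\<in>full_rank_rows m k. f xs)"
  using assms(1)
proof (induction n rule: dec_induct)
  case base
  have "map (trunc k) zs = zs" if "zs \<in> full_rank_rows m k" for zs :: "(nat \<Rightarrow> 'a) list"
    using that by (intro map_idI) (auto simp: full_rank_rows_def trunc_id)
  then show ?case by simp
next
  case (step n)
  have "trunc k \<circ> trunc n = (trunc k :: _ \<Rightarrow> nat \<Rightarrow> 'a)"
    using step.hyps by (auto simp: trunc_def fun_eq_iff)
  then have "(\<Sum>zs\<in>full_rank_rows m (Suc n). f (map (trunc k) zs)) =
      (\<Sum>zs\<in>full_rank_rows m (Suc n). f (map (trunc k) (map (trunc n) zs)))"
    by simp
  also have "\<dots> = (Q ^ m - Q ^ n) * (\<Sum>zs\<in>full_rank_rows m n. f (map (trunc k) zs))"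
    unfolding Q_def by (rule sum_full_rank_rows_Suc)
  finally show ?case
    using step by (simp add: mult_ac)
qed

lemma card_full_rank_rows:
  defines "Q \<equiv> of_nat CARD('a :: {field, finite}) :: complex"
  shows "of_nat (card (full_rank_rows m n :: (nat \<Rightarrow> 'a) list set)) = (\<Prod>i<n. Q ^ m - Q ^ i)"
proof -
  \<comment> \<open>There is one matrix with \<open>m\<close> rows and no columns, so the count is
    the case \<open>k = 0\<close> of the previous sum formula.\<close>
  have "full_rank_rows m 0 = {replicate m (0 :: nat \<Rightarrow> 'a)}"
    by (auto simp: full_rank_rows_def coord_space_0 intro!: replicate_eqI)
  then show ?thesis
    using sum_full_rank_rows[of 0 n "\<lambda>_ :: (nat \<Rightarrow> 'a) list. 1" m] by (simp add: Q_def atLeast0LessThan)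
qed

section \<open>Character sum of an invertible hermitian matrix\<close>

context hermitian_field
begin

text \<open>Assumption \<open>nd\<close> makes the form of \<open>C\<close> nondegenerate, so
  \<open>frame_sum_nondegenerate\<close> applies. Full rank is expressed through \<open>dot\<close>
  and spanning through \<open>h\<close>; the bijection \<open>M\<close> translates between the
  two.\<close>

lemma sum_full_rank_rows_chi:
  fixes C :: "nat \<Rightarrow> nat \<Rightarrow> 'a"
  assumes herm: "\<And>i l. C l i = C i l ^ q"
    and nd: "\<And>a. a \<in> coord_space k \<Longrightarrow> (\<And>i. i < k \<Longrightarrow> (\<Sum>l<k. C i l * a l ^ q) = 0) \<Longrightarrow> a = 0"
  defines "b \<equiv> - of_nat q :: complex"
  shows "(\<Sum>xs\<in>full_rank_rows m k. \<chi> (\<Sum>x\<leftarrow>xs. \<Sum>i<k. \<Sum>l<k. x i * C i l * x l ^ q)) =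
    (\<Prod>i<k. b ^ (m + i) - b ^ (2 * i))"
proof -
  define h where "h x y = (\<Sum>i<k. \<Sum>l<k. x i * C i l * y l ^ q)" for x y
  interpret hermitian_form q \<chi> "\<lambda>c x i. c * x i" h
  proof unfold_locales
    fix x y :: "nat \<Rightarrow> 'a"
    have "h x y ^ q = (\<Sum>i<k. \<Sum>l<k. y l * C l i * x i ^ q)"
      unfolding h_def conj_sum
      by (intro sum.cong refl) (simp add: power_mult_distrib mult_ac flip: herm)
    also have "\<dots> = h y x"
      unfolding h_def by (rule sum.swap)
    finally show "h y x = h x y ^ q" ..
  qed (auto simp: h_def fun_eq_iff algebra_simps sum.distrib sum_distrib_left)
  \<comment> \<open>\<open>M a\<close> is \<open>C\<close> applied to the conjugate of
    \<open>a\<close>.\<close>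
  define M where "M a = (\<lambda>i. if i < k then \<Sum>l<k. C i l * a l ^ q else 0)" for a
  have hM: "h x a = dot k x (M a)" for x a
    unfolding h_def dot_def M_def by (intro sum.cong refl) (simp add: sum_distrib_left mult.assoc)
  have M_coord: "M a \<in> coord_space k" for a
    by (simp add: M_def coord_space_def)
  have M0: "a = 0" if "a \<in> coord_space k" "M a = 0" for a
  proof (rule nd[OF that(1)])
    fix i assume "i < k"
    then show "(\<Sum>l<k. C i l * a l ^ q) = 0"
      using fun_cong[OF that(2), of i] by (simp add: M_def)
  qed
  have M_diff: "M (a - a') = M a - M a'" for a a'
  proof -
    have "C i l * (a l - a' l) ^ q = C i l * a l ^ q - C i l * a' l ^ q" for i l
      using conj_add[of "a l" "- a' l"] by (simp add: conj_minus right_diff_distrib)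
    then show ?thesis
      by (auto simp: M_def fun_eq_iff sum_subtractf)
  qed
  have "inj_on M (coord_space k)"
  proof (rule inj_onI)
    fix a a' assume *: "a \<in> coord_space k" "a' \<in> coord_space k" "M a = M a'"
    have "M (a - a') = 0"
      unfolding M_diff *(3) by (rule diff_self)
    then have "a - a' = 0"
      by (rule M0[OF coord_space_diff[OF *(1,2)]])
    then show "a = a'" by simp
  qed
  \<comment> \<open>An injective map of the finite set \<open>coord_space k\<close> into itself is
    onto.\<close>
  then have M_surj: "M ` coord_space k = coord_space k"
    using M_coord by (intro endo_inj_surj) auto
  have M_zero: "M 0 = 0"
    using q_gt_1 by (auto simp: M_def)
  have zero: "(0 :: nat \<Rightarrow> 'a) \<in> coord_space k"
    by (simp add: coord_space_def)
  have "nondegenerate (coord_space k)"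
    unfolding nondegenerate_def
  proof (intro conjI ballI impI)
    show "subspace (coord_space k)"
      by (rule subspaceI) (auto simp: coord_space_def)
    fix a assume a: "a \<in> coord_space k" "\<forall>x\<in>coord_space k. h x a = 0"
    show "a = 0"
    proof (rule nd[OF a(1)])
      fix i assume i: "i < k"
      \<comment> \<open>Testing against a standard basis vector extracts the equation for index
        \<open>i\<close>.\<close>
      have "h (\<lambda>j. if j = i then 1 else 0) a = 0"
        using a(2) i by (auto simp: coord_space_def)
      then show "(\<Sum>l<k. C i l * a l ^ q) = 0"
        using i unfolding h_def by (subst (asm) sum.remove[of _ i]) auto
    qed
  qed simp
  moreover have "card (coord_space k :: (nat \<Rightarrow> 'a) set) = q ^ (2 * k)"
    by (simp add: card_coord_space card_field power_mult)
  ultimately have "frame_sum m (coord_space k) = (\<Prod>i<k. b ^ (m + i) - b ^ (2 * i))"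
    unfolding b_def by (rule frame_sum_nondegenerate)
  moreover have "full_rank_rows m k =
      {xs \<in> vlists m (coord_space k). ann (coord_space k) (set xs) = {0}}"
  proof (intro Set.set_eqI)
    fix xs :: "(nat \<Rightarrow> 'a) list"
    have "(\<forall>a\<in>coord_space k. (\<forall>x\<in>set xs. dot k x a = 0) \<longrightarrow> a = 0) \<longleftrightarrow>
        (\<forall>a\<in>M ` coord_space k. (\<forall>x\<in>set xs. dot k x a = 0) \<longrightarrow> a = 0)"
      unfolding M_surj ..
    also have "\<dots> \<longleftrightarrow> (\<forall>a\<in>coord_space k. (\<forall>x\<in>set xs. h x a = 0) \<longrightarrow> a = 0)"
      unfolding hM using M0 M_zero by auto
    also have "\<dots> \<longleftrightarrow> ann (coord_space k) (set xs) = {0}"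
      using zero unfolding ann_def by (auto simp del: zero_fun_apply)
    finally show "xs \<in> full_rank_rows m k \<longleftrightarrow>
        xs \<in> {xs \<in> vlists m (coord_space k). ann (coord_space k) (set xs) = {0}}"
      by (auto simp: full_rank_rows_def vlists_def)
  qed
  ultimately show ?thesis
    unfolding frame_sum_def chi_list_def by (simp only: h_def)
qed

end

section \<open>Hermitian matrices of given rank\<close>

text \<open>Gauss-Jordan elimination provides \<open>P\<close> and the pivots. Their number is
  identified with the rank by showing that the pivot columns of \<open>A\<close> form a maximal
  independent set of columns.\<close>

lemma row_echelon_rank:
  fixes A :: "'a :: field mat"
  assumes A: "A \<in> carrier_mat n n"
  defines "k \<equiv> vec_space.rank n A"
  obtains P R f where
    "P \<in> carrier_mat n n" "R \<in> carrier_mat n n" "P * R = 1\<^sub>m n" "R * P = 1\<^sub>m n" "k \<le> n"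
    "\<And>i j. k \<le> i \<Longrightarrow> i < n \<Longrightarrow> j < n \<Longrightarrow> (P * A) $$ (i, j) = 0"
    "\<And>i. i < k \<Longrightarrow> f i < n"
    "\<And>i i'. i < k \<Longrightarrow> i' < n \<Longrightarrow> (P * A) $$ (i', f i) = (if i' = i then 1 else 0)"
proof -
  interpret vec_space "TYPE('a)" n .
  define C where "C = gauss_jordan_single A"
  note gj = gauss_jordan_single[OF A C_def[symmetric]]
  have C: "C \<in> carrier_mat n n"
    by (rule gj(2))
  obtain P R where P: "C = P * A" "P \<in> carrier_mat n n" "R \<in> carrier_mat n n"
    "P * R = 1\<^sub>m n" "R * P = 1\<^sub>m n"
    using gj(4) by blast
  obtain f where "pivot_fun C f n"
    using gj(3) C by (auto simp: row_echelon_form_def)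
  from pivot_funD[OF _ this, of n] C have
    f_le: "\<And>i. i < n \<Longrightarrow> f i \<le> n" and
    f_zero: "\<And>i j. i < n \<Longrightarrow> j < f i \<Longrightarrow> C $$ (i, j) = 0" and
    f_Suc: "\<And>i. Suc i < n \<Longrightarrow> f i < f (Suc i) \<or> f (Suc i) = n" and
    f_one: "\<And>i. i < n \<Longrightarrow> f i < n \<Longrightarrow> C $$ (i, f i) = 1" and
    f_other: "\<And>i i'. i < n \<Longrightarrow> f i < n \<Longrightarrow> i' < n \<Longrightarrow> i' \<noteq> i \<Longrightarrow> C $$ (i', f i) = 0"
    by auto
  \<comment> \<open>\<open>r\<close> is the index of the first zero row of \<open>C\<close>; the
    guard \<open>i < n\<close> makes it \<open>n\<close> if there is none.\<close>
  define r where "r = (LEAST i. i < n \<longrightarrow> f i = n)"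
  have r_le: "r \<le> n"
    unfolding r_def by (rule Least_le) simp
  have f_lt: "f i < n" if "i < r" for i
    using not_less_Least[OF that[unfolded r_def]] f_le[of i] by auto
  have f_n: "f i = n" if "r \<le> i" "i < n" for i
    using that
  proof (induction i rule: dec_induct)
    case base
    then show ?case
      using LeastI[of "\<lambda>i. i < n \<longrightarrow> f i = n" n] by (simp add: r_def)
  next
    case (step i)
    then show ?case
      using f_Suc[of i] f_le[of "Suc i"] by auto
  qed
  have C_zero: "C $$ (i, j) = 0" if "r \<le> i" "i < n" "j < n" for i j
    using f_zero[of i j] f_n[of i] that by simp
  have C_pivot: "C $$ (i', f i) = (if i' = i then 1 else 0)" if "i < r" "i' < n" for i i'
    using f_one[of i] f_other[of i i'] f_lt[OF that(1)] that r_le by auto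
  have A_eq: "A = R * C"
    using P A by (simp flip: assoc_mult_mat[of R n n P n A n])
  have A_entry: "A $$ (m, j) = (\<Sum>i<r. R $$ (m, i) * C $$ (i, j))" if "m < n" "j < n" for m j
  proof -
    have "A $$ (m, j) = (\<Sum>i<n. R $$ (m, i) * C $$ (i, j))"
      using P(3) C that by (subst A_eq) (simp add: scalar_prod_def atLeast0LessThan)
    also have "\<dots> = (\<Sum>i<r. R $$ (m, i) * C $$ (i, j))"
      using r_le C_zero that by (intro sum.mono_neutral_right) auto
    finally show ?thesis .
  qed
  have "det R * det P = 1"
    using P det_mult[of R n P] by simp
  then have rank_R: "rank R = n"
    using det_rank_iff[OF P(3)] by auto
  then have distinct: "distinct (cols R)"
    using non_distinct_low_rank[OF P(3)] by (metis less_irrefl)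
  have indpt: "lin_indpt (set (cols R))"
    by (rule full_rank_lin_indpt[OF P(3) rank_R distinct])
  have inj: "inj_on (col R) {..<n}"
  proof (rule inj_onI)
    fix i j assume "i \<in> {..<n}" "j \<in> {..<n}" "col R i = col R j"
    then show "i = j"
      using distinct P(3) nth_eq_iff_index_eq[OF distinct, of i j] by (simp add: cols_nth)
  qed
  \<comment> \<open>These are the pivot columns of \<open>A\<close>, because column
    \<open>f i\<close> of \<open>C\<close> is the standard basis vector \<open>i\<close>. They are
    independent as columns of the invertible matrix \<open>R\<close>.\<close>
  define S where "S = col R ` {..<r}"
  have S_cols: "S \<subseteq> set (cols R)"
    using P(3) r_le by (auto simp: S_def cols_def)
  have S_carrier: "S \<subseteq> carrier_vec n"
    using P(3) by (auto simp: S_def)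
  have S_indpt: "lin_indpt S"
    by (rule subset_li_is_li[OF indpt S_cols])
  have card_S: "card S = r"
    unfolding S_def using inj r_le by (subst card_image) (auto intro: inj_on_subset)
  have S_colsA: "S \<subseteq> set (cols A)"
  proof
    fix v assume "v \<in> S"
    then obtain i where i: "i < r" "v = col R i"
      by (auto simp: S_def)
    have "v = col A (f i)"
    proof (rule eq_vecI)
      fix m assume "m < dim_vec (col A (f i))"
      then have m: "m < n"
        using A by simp
      have "col A (f i) $ m = (\<Sum>i'<r. R $$ (m, i') * C $$ (i', f i))"
        using A m f_lt[OF i(1)] by (simp add: A_entry)
      also have "\<dots> = (\<Sum>i'<r. if i' = i then R $$ (m, i') else 0)"
        using r_le i(1) by (intro sum.cong refl) (auto simp: C_pivot)
      also have "\<dots> = v $ m"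
        using i P(3) m r_le by simp
      finally show "v $ m = col A (f i) $ m" ..
    qed (use A P(3) i in simp)
    then show "v \<in> set (cols A)"
      using f_lt[OF i(1)] A by (auto simp: cols_def)
  qed
  have cols_span: "v \<in> span S" if "v \<in> set (cols A)" for v
  proof -
    obtain j where j: "j < n" "v = col A j"
      using \<open>v \<in> set (cols A)\<close> A by (auto simp: cols_def)
    \<comment> \<open>By \<open>A = R * C\<close>, column \<open>i\<close> of \<open>R\<close> has
      coefficient \<open>C $$ (i, j)\<close>; the inverse of \<open>col R\<close> recovers
      \<open>i\<close> from the vector.\<close>
    let ?a = "\<lambda>w. C $$ (the_inv_into {..<n} (col R) w, j)"
    have "v = lincomb ?a S"
    proof (rule eq_vecI)
      have dim: "dim_vec (lincomb ?a S) = n"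
        using S_carrier by (rule lincomb_dim[rotated]) (simp add: S_def)
      then show "dim_vec v = dim_vec (lincomb ?a S)"
        using j A by simp
      fix m assume "m < dim_vec (lincomb ?a S)"
      then have m: "m < n"
        using dim by simp
      have "lincomb ?a S $ m = (\<Sum>w\<in>S. ?a w * w $ m)"
        using m S_carrier by (rule lincomb_index)
      also have "\<dots> = (\<Sum>i<r. ?a (col R i) * col R i $ m)"
        unfolding S_def using inj r_le by (subst sum.reindex) (auto intro: inj_on_subset)
      also have "\<dots> = (\<Sum>i<r. R $$ (m, i) * C $$ (i, j))"
        using inj r_le P(3) m by (intro sum.cong refl) (simp add: the_inv_into_f_f)
      finally show "v $ m = lincomb ?a S $ m"
        using A_entry[OF m j(1)] j A m by simp
    qed
    then show ?thesis
      by (rule in_spanI[where A = S]) (auto simp: S_def)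
  qed
  have "maximal S (\<lambda>T. T \<subseteq> set (cols A) \<and> lin_indpt T)"
    unfolding maximal_def
  proof (intro conjI allI impI)
    fix T assume T: "S \<subseteq> T \<and> T \<subseteq> set (cols A) \<and> lin_indpt T"
    show "T = S"
    proof (rule ccontr)
      assume "T \<noteq> S"
      then obtain v where v: "v \<in> T" "v \<notin> S"
        using T by blast
      then have "v \<in> carrier_vec n"
        using T A cols_dim[of A] by auto
      moreover have "v \<in> span S"
        using cols_span v T by blast
      ultimately have "lin_dep (S \<union> {v})"
        using lin_dep_iff_in_span[OF S_carrier S_indpt, of v] v(2) by (simp only: simp_thms)
      moreover have "lin_indpt (S \<union> {v})"
        using T v(1) by (metis subset_li_is_li Un_insert_right insert_subset sup_bot_right)
      ultimately show False
        by (rule notE[rotated])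
    qed
  qed (use S_colsA S_indpt in auto)
  then have "k = r"
    unfolding k_def using rank_card_indpt[OF A] card_S by simp
  then show thesis
    using that[of P R f] P r_le f_lt C_zero C_pivot by simp
qed

section \<open>Row vectors multiplied by a square matrix\<close>

definition row_act :: "nat \<Rightarrow> (nat \<Rightarrow> nat \<Rightarrow> 'a) \<Rightarrow> (nat \<Rightarrow> 'a) \<Rightarrow> nat \<Rightarrow> 'a :: field" where
  "row_act n P x = (\<lambda>j. if j < n then \<Sum>i<n. x i * P i j else 0)"

lemma row_act_coord_space [simp]: "row_act n P x \<in> coord_space n"
  by (simp add: row_act_def coord_space_def)

lemma row_act_0 [simp]: "row_act n P 0 = 0"
  by (simp add: row_act_def fun_eq_iff)

lemma row_act_inverse:
  assumes "\<And>i j. i < n \<Longrightarrow> j < n \<Longrightarrow> (\<Sum>t<n. P i t * R t j) = (if i = j then 1 else 0)"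
    and x: "x \<in> coord_space n"
  shows "row_act n R (row_act n P x) = x"
proof
  fix j
  show "row_act n R (row_act n P x) j = x j"
  proof (cases "j < n")
    case True
    have "row_act n R (row_act n P x) j = (\<Sum>t<n. \<Sum>i<n. x i * P i t * R t j)"
      using True by (simp add: row_act_def sum_distrib_right)
    also have "\<dots> = (\<Sum>i<n. \<Sum>t<n. x i * P i t * R t j)"
      by (rule sum.swap)
    also have "\<dots> = (\<Sum>i<n. if i = j then x i else 0)"
      using assms(1) True by (intro sum.cong refl) (simp add: mult.assoc flip: sum_distrib_left)
    finally show ?thesis
      using True by simp
  next
    case False
    then show ?thesis
      using x by (simp add: row_act_def coord_space_def)
  qed
qed

lemma dot_row_act: "dot n (row_act n P x) a = dot n x (row_act n (\<lambda>i j. P j i) a)"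
proof -
  have "dot n (row_act n P x) a = (\<Sum>j<n. \<Sum>i<n. x i * P i j * a j)"
    by (simp add: dot_def row_act_def sum_distrib_right)
  also have "\<dots> = (\<Sum>i<n. \<Sum>j<n. x i * P i j * a j)"
    by (rule sum.swap)
  also have "\<dots> = dot n x (row_act n (\<lambda>i j. P j i) a)"
    by (simp add: dot_def row_act_def sum_distrib_left mult_ac)
  finally show ?thesis .
qed

text \<open>If \<open>a\<close> is in the kernel after multiplication of the rows by
  \<open>P\<close>, then \<open>P\<close> applied to \<open>a\<close> is in the original kernel,
  hence 0; applying \<open>R\<close> gives \<open>a = 0\<close>.\<close>

lemma row_act_full_rank_rows:
  assumes inv: "\<And>i j. i < n \<Longrightarrow> j < n \<Longrightarrow> (\<Sum>t<n. R i t * P t j) = (if i = j then 1 else 0)"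
    and xs: "xs \<in> full_rank_rows m n"
  shows "map (row_act n P) xs \<in> full_rank_rows m n"
  unfolding full_rank_rows_def
proof (intro CollectI conjI ballI impI)
  fix a assume a: "a \<in> coord_space n" "\<forall>x\<in>set (map (row_act n P) xs). dot n x a = 0"
  let ?Pa = "row_act n (\<lambda>i j. P j i) a"
  have "\<forall>x\<in>set xs. dot n x ?Pa = 0"
    using a(2) by (simp add: dot_row_act)
  then have "?Pa = 0"
    using xs row_act_coord_space unfolding full_rank_rows_def by blast
  moreover have "row_act n (\<lambda>i j. R j i) ?Pa = a"
  proof (rule row_act_inverse[OF _ a(1)])
    fix i j assume "i < n" "j < n"
    have "(\<Sum>t<n. P t i * R j t) = (\<Sum>t<n. R j t * P t i)"
      by (intro sum.cong refl mult.commute)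
    also have "\<dots> = (if i = j then 1 else 0)"
      using inv[OF \<open>j < n\<close> \<open>i < n\<close>] by auto
    finally show "(\<Sum>t<n. P t i * R j t) = (if i = j then 1 else 0)" .
  qed
  ultimately show "a = 0"
    by simp
qed (use xs in \<open>auto simp: full_rank_rows_def\<close>)

section \<open>Character sum of a hermitian matrix of arbitrary rank\<close>

context hermitian_field
begin

text \<open>Summed over the rows of \<open>X\<close>, these values give the trace of
  \<open>X\<close> times \<open>A\<close> times the conjugate transpose of \<open>X\<close>.\<close>

definition mat_form :: "nat \<Rightarrow> 'a mat \<Rightarrow> (nat \<Rightarrow> 'a) \<Rightarrow> 'a" where
  "mat_form n A x = (\<Sum>j<n. \<Sum>l<n. x j * A $$ (j, l) * x l ^ q)"

text \<open>Multiplying the rows by an invertible \<open>P\<close> replaces \<open>A\<close> by a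
  congruent matrix \<open>B\<close> that lives in the leading \<open>k\<close> by \<open>k\<close>
  block and is invertible there. The second product is the sum for this block; the first counts the
  extensions by \<open>n - k\<close> further columns.\<close>

theorem sum_chi_mat_form:
  assumes herm: "A \<in> hermitian_mats q n"
  defines "k \<equiv> vec_space.rank n A" and "b \<equiv> - of_nat q :: complex"
  shows "k \<le> n" and "(\<Sum>xs\<in>full_rank_rows n n. \<chi> (\<Sum>x\<leftarrow>xs. mat_form n A x)) =
    (\<Prod>i=k..<n. b ^ (2 * n) - b ^ (2 * i)) * (\<Prod>i<k. b ^ (n + i) - b ^ (2 * i))"
proof -
  have A: "A \<in> carrier_mat n n" and AT: "transpose_mat (map_mat (\<lambda>x. x ^ q) A) = A"
    using herm by (auto simp: hermitian_mats_def)
  have A_conj: "A $$ (j, l) ^ q = A $$ (l, j)" if "j < n" "l < n" for j l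
  proof -
    have "transpose_mat (map_mat (\<lambda>x. x ^ q) A) $$ (l, j) = A $$ (j, l) ^ q"
      using A that by simp
    then show ?thesis
      unfolding AT by simp
  qed
  obtain P R f where P: "P \<in> carrier_mat n n" "R \<in> carrier_mat n n" "P * R = 1\<^sub>m n" "R * P = 1\<^sub>m n"
    and k: "k \<le> n"
    and C_zero: "\<And>i j. k \<le> i \<Longrightarrow> i < n \<Longrightarrow> j < n \<Longrightarrow> (P * A) $$ (i, j) = 0"
    and f: "\<And>i. i < k \<Longrightarrow> f i < n"
    and C_pivot: "\<And>i i'. i < k \<Longrightarrow> i' < n \<Longrightarrow> (P * A) $$ (i', f i) = (if i' = i then 1 else 0)"
    using row_echelon_rank[OF A] unfolding k_def by blast
  show "k \<le> n" by (rule k)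
  let ?p = "\<lambda>i j. P $$ (i, j)" and ?r = "\<lambda>i j. R $$ (i, j)"
  have entry: "(\<Sum>t<n. M $$ (i, t) * N $$ (t, j)) = (M * N) $$ (i, j)"
    if "M \<in> carrier_mat n n" "N \<in> carrier_mat n n" "i < n" "j < n" for M N :: "'a mat" and i j
    using that by (simp add: scalar_prod_def atLeast0LessThan)
  have inv: "(\<Sum>t<n. ?p i t * ?r t j) = (if i = j then 1 else 0)"
    "(\<Sum>t<n. ?r i t * ?p t j) = (if i = j then 1 else 0)" if "i < n" "j < n" for i j
    using entry[OF P(1,2) that] entry[OF P(2,1) that] P(3,4) that by simp_all
  \<comment> \<open>\<open>B\<close> is \<open>P\<close> times \<open>A\<close> times the conjugate
    transpose of \<open>P\<close>.\<close>
  define B where "B i l = (\<Sum>j<n. \<Sum>m<n. ?p i j * A $$ (j, m) * ?p l m ^ q)" for i l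
  have B_conj: "B l i = B i l ^ q" for i l
  proof -
    have "B i l ^ q = (\<Sum>j<n. \<Sum>m<n. ?p l m * A $$ (m, j) * ?p i j ^ q)"
      unfolding B_def conj_sum
      by (intro sum.cong refl) (simp add: power_mult_distrib A_conj mult_ac)
    also have "\<dots> = B l i"
      unfolding B_def by (rule sum.swap)
    finally show ?thesis ..
  qed
  have B_C: "B i l = (\<Sum>m<n. (P * A) $$ (i, m) * ?p l m ^ q)" if "i < n" for i l
  proof -
    have "B i l = (\<Sum>m<n. \<Sum>j<n. ?p i j * A $$ (j, m) * ?p l m ^ q)"
      unfolding B_def by (rule sum.swap)
    also have "\<dots> = (\<Sum>m<n. (P * A) $$ (i, m) * ?p l m ^ q)"
      using that by (intro sum.cong refl) (simp add: entry[OF P(1) A, symmetric] flip: sum_distrib_right)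
    finally show ?thesis .
  qed
  \<comment> \<open>The rows of \<open>P * A\<close> vanish from \<open>k\<close> on, hence those of
    \<open>B\<close>; hermitian symmetry extends this to columns.\<close>
  have B_zero: "B i l = 0" if "i < n" "l < n" "k \<le> i \<or> k \<le> l" for i l
  proof -
    have *: "B i l = 0" if "i < n" "k \<le> i" for i l
      using that by (simp add: B_C C_zero)
    show ?thesis
      using that *[of i l] *[of l i] B_conj[of i l] q_gt_1 by auto
  qed
  have nd: "a = 0" if a: "a \<in> coord_space k" "\<And>i. i < k \<Longrightarrow> (\<Sum>l<k. B i l * a l ^ q) = 0" for a
  proof -
    \<comment> \<open>\<open>y\<close> is the row vector \<open>a\<close> times
      \<open>P * A\<close>. The hypothesis says that \<open>y\<close> times the conjugate transpose
      of \<open>P\<close> is 0; the conjugates of the entries of \<open>R\<close> invert this, so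
      \<open>y = 0\<close>, and its pivot positions return the entries of \<open>a\<close>.\<close>
    define y where "y m = (\<Sum>l<n. a l * (P * A) $$ (l, m))" for m
    have a0: "a l = 0" if "k \<le> l" for l
      using a(1) that by (simp add: coord_space_def)
    have y_P: "(\<Sum>m<n. y m * ?p i m ^ q) = 0" if i: "i < n" for i
    proof -
      have "(\<Sum>m<n. y m * ?p i m ^ q) = (\<Sum>m<n. \<Sum>l<n. a l * ((P * A) $$ (l, m) * ?p i m ^ q))"
        by (simp add: y_def sum_distrib_right mult.assoc)
      also have "\<dots> = (\<Sum>l<n. \<Sum>m<n. a l * ((P * A) $$ (l, m) * ?p i m ^ q))"
        by (rule sum.swap)
      also have "\<dots> = (\<Sum>l<n. a l * B l i)"
        by (intro sum.cong refl) (simp add: B_C sum_distrib_left)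
      also have "\<dots> = (\<Sum>l<k. a l * B l i)"
        using k a0 by (intro sum.mono_neutral_right) auto
      also have "\<dots> = (\<Sum>l<k. B i l * a l ^ q) ^ q"
        unfolding conj_sum by (intro sum.cong refl) (simp add: power_mult_distrib B_conj[of _ i] mult.commute)
      also have "\<dots> = 0"
      proof (cases "i < k")
        case False
        then have "(\<Sum>l<k. B i l * a l ^ q) = 0"
          using i k by (intro sum.neutral) (simp add: B_zero)
        then show ?thesis
          using q_gt_1 by simp
      qed (use q_gt_1 in \<open>simp add: a(2)\<close>)
      finally show ?thesis .
    qed
    have y0: "y t = 0" if t: "t < n" for t
    proof -
      have "0 = (\<Sum>i<n. ?r t i ^ q * (\<Sum>m<n. y m * ?p i m ^ q))"
        by (simp add: y_P)
      also have "\<dots> = (\<Sum>i<n. \<Sum>m<n. y m * (?r t i * ?p i m) ^ q)"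
        by (simp add: sum_distrib_left power_mult_distrib mult_ac)
      also have "\<dots> = (\<Sum>m<n. \<Sum>i<n. y m * (?r t i * ?p i m) ^ q)"
        by (rule sum.swap)
      also have "\<dots> = (\<Sum>m<n. y m * (\<Sum>i<n. ?r t i * ?p i m) ^ q)"
        by (simp add: conj_sum sum_distrib_left)
      also have "\<dots> = (\<Sum>m<n. if m = t then y m else 0)"
        using t q_gt_1 by (intro sum.cong refl) (simp add: inv(2))
      finally show ?thesis
        using t by simp
    qed
    have "a i = 0" if i: "i < k" for i
    proof -
      have "y (f i) = (\<Sum>l<n. if l = i then a l else 0)"
        unfolding y_def using i by (intro sum.cong refl) (simp add: C_pivot)
      then show ?thesis
        using i k y0[OF f[OF i]] by simp
    qed
    then show ?thesis
      using a0 by (auto simp: fun_eq_iff not_less[symmetric])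
  qed
  have form: "mat_form n A (row_act n ?p x) = (\<Sum>i<k. \<Sum>l<k. x i * B i l * x l ^ q)" for x
  proof -
    have "mat_form n A (row_act n ?p x) =
        (\<Sum>j<n. \<Sum>m<n. (\<Sum>i<n. x i * ?p i j) * A $$ (j, m) * (\<Sum>l<n. (x l * ?p l m) ^ q))"
      by (simp add: mat_form_def row_act_def conj_sum)
    also have "\<dots> = (\<Sum>j<n. \<Sum>m<n. \<Sum>i<n. \<Sum>l<n. x i * (?p i j * A $$ (j, m) * ?p l m ^ q) * x l ^ q)"
      by (intro sum.cong refl) (simp add: sum_distrib_left sum_distrib_right power_mult_distrib mult_ac)
    \<comment> \<open>The sums over \<open>j\<close> and \<open>m\<close> are moved innermost, where
      they form \<open>B i l\<close>.\<close>
    also have "\<dots> = (\<Sum>j<n. \<Sum>i<n. \<Sum>m<n. \<Sum>l<n. x i * (?p i j * A $$ (j, m) * ?p l m ^ q) * x l ^ q)"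
      by (intro sum.cong refl sum.swap)
    also have "\<dots> = (\<Sum>j<n. \<Sum>i<n. \<Sum>l<n. \<Sum>m<n. x i * (?p i j * A $$ (j, m) * ?p l m ^ q) * x l ^ q)"
      by (intro sum.cong refl sum.swap)
    also have "\<dots> = (\<Sum>i<n. \<Sum>j<n. \<Sum>l<n. \<Sum>m<n. x i * (?p i j * A $$ (j, m) * ?p l m ^ q) * x l ^ q)"
      by (rule sum.swap)
    also have "\<dots> = (\<Sum>i<n. \<Sum>l<n. \<Sum>j<n. \<Sum>m<n. x i * (?p i j * A $$ (j, m) * ?p l m ^ q) * x l ^ q)"
      by (intro sum.cong refl sum.swap)
    also have "\<dots> = (\<Sum>i<n. \<Sum>l<n. x i * B i l * x l ^ q)"
      unfolding B_def by (simp add: sum_distrib_left sum_distrib_right)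
    also have "\<dots> = (\<Sum>i<n. \<Sum>l<k. x i * B i l * x l ^ q)"
      using k by (intro sum.cong[OF refl] sum.mono_neutral_right) (auto simp: B_zero)
    also have "\<dots> = (\<Sum>i<k. \<Sum>l<k. x i * B i l * x l ^ q)"
      using k by (intro sum.mono_neutral_right) (auto simp: B_zero intro!: sum.neutral)
    finally show ?thesis .
  qed
  let ?g = "\<lambda>xs. \<chi> (\<Sum>x\<leftarrow>xs. \<Sum>i<k. \<Sum>l<k. x i * B i l * x l ^ q)"
  have bij: "bij_betw (map (row_act n ?p)) (full_rank_rows n n) (full_rank_rows n n)"
  proof (rule bij_betw_byWitness[where f' = "map (row_act n ?r)"])
    have "row_act n ?r (row_act n ?p x) = x" "row_act n ?p (row_act n ?r x) = x" if "x \<in> coord_space n" for x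
      using row_act_inverse[OF inv(1) that] row_act_inverse[OF inv(2) that] by simp_all
    then have "map (row_act n ?r) (map (row_act n ?p) xs) = xs" "map (row_act n ?p) (map (row_act n ?r) xs) = xs"
      if "xs \<in> full_rank_rows n n" for xs
      using that unfolding full_rank_rows_def map_map by (auto intro!: map_idI)
    then show "\<forall>xs\<in>full_rank_rows n n. map (row_act n ?r) (map (row_act n ?p) xs) = xs"
      "\<forall>xs\<in>full_rank_rows n n. map (row_act n ?p) (map (row_act n ?r) xs) = xs"
      by blast+
    show "map (row_act n ?p) ` full_rank_rows n n \<subseteq> full_rank_rows n n"
      by (intro image_subsetI row_act_full_rank_rows[OF inv(2)])
    show "map (row_act n ?r) ` full_rank_rows n n \<subseteq> full_rank_rows n n"
      by (intro image_subsetI row_act_full_rank_rows[OF inv(1)])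
  qed
  have "(\<Sum>xs\<in>full_rank_rows n n. \<chi> (\<Sum>x\<leftarrow>xs. mat_form n A x)) =
      (\<Sum>xs\<in>full_rank_rows n n. \<chi> (\<Sum>x\<leftarrow>map (row_act n ?p) xs. mat_form n A x))"
    by (rule sum.reindex_bij_betw[OF bij, symmetric])
  also have "\<dots> = (\<Sum>xs\<in>full_rank_rows n n. ?g xs)"
    by (simp add: o_def form)
  \<comment> \<open>The reduced form involves only coordinates below \<open>k\<close>.\<close>
  also have "\<dots> = (\<Sum>xs\<in>full_rank_rows n n. ?g (map (trunc k) xs))"
    by (simp add: o_def trunc_def)
  also have "\<dots> = (\<Prod>i=k..<n. of_nat CARD('a) ^ n - of_nat CARD('a) ^ i) * (\<Sum>xs\<in>full_rank_rows n k. ?g xs)"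
    by (rule sum_full_rank_rows[OF k])
  also have "(\<Sum>xs\<in>full_rank_rows n k. ?g xs) = (\<Prod>i<k. b ^ (n + i) - b ^ (2 * i))"
    unfolding b_def by (rule sum_full_rank_rows_chi[OF B_conj nd])
  also have "of_nat CARD('a) = b ^ 2"
    by (simp add: card_field b_def)
  finally show "(\<Sum>xs\<in>full_rank_rows n n. \<chi> (\<Sum>x\<leftarrow>xs. mat_form n A x)) =
    (\<Prod>i=k..<n. b ^ (2 * n) - b ^ (2 * i)) * (\<Prod>i<k. b ^ (n + i) - b ^ (2 * i))"
    by (simp add: power_mult)
qed

end

section \<open>The bound\<close>

text \<open>Consecutive exponents have opposite parity, so each of the \<open>t\<close> pairs of
  factors gives \<open>- 1\<close>.\<close>

lemma prod_alternating:
  assumes "2 * t \<le> n"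
  shows "(\<Prod>i<2 * t. (- 1) ^ (n - i)) = (- 1 :: real) ^ t"
  using assms
proof (induction t)
  case (Suc t)
  have "n - 2 * t = Suc (n - Suc (2 * t))"
    using Suc.prems by simp
  then have "(- 1 :: real) ^ (n - 2 * t) * (- 1) ^ (n - Suc (2 * t)) = - 1"
    by (simp flip: power_add power_mult_distrib)
  then show ?case
    using Suc by (simp add: mult.assoc)
qed simp

text \<open>Each factor yields the sign \<open>(- 1) ^ (n - i)\<close>. The congruence makes
  \<open>k\<close> twice an odd number, so the signs multiply to \<open>- 1\<close>.\<close>

lemma prod_neg_base:
  fixes q :: nat
  assumes "k \<le> n" "[k = 2] (mod 4)"
  shows "(\<Prod>i<k. (- real q) ^ (n - i) + 1) =
    - (\<Prod>i = 1..k. real q ^ (n - i + 1) + (- 1) ^ (n - i + 1))"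
proof -
  have "k mod 4 = 2"
    using assms(2) by (simp add: cong_def)
  define t where "t = 2 * (k div 4) + 1"
  have t: "k = 2 * t" "odd t"
    using mult_div_mod_eq[of 4 k] \<open>k mod 4 = 2\<close> by (simp_all add: t_def)
  have "(\<Prod>i<k. (- real q) ^ (n - i) + 1) =
      (\<Prod>i<k. (- 1) ^ (n - i) * (real q ^ (n - i) + (- 1) ^ (n - i)))"
  proof (intro prod.cong refl)
    fix i
    have "(- 1 :: real) ^ (n - i) * (- 1) ^ (n - i) = 1"
      by (simp flip: power_mult_distrib)
    then show "(- real q) ^ (n - i) + 1 = (- 1) ^ (n - i) * (real q ^ (n - i) + (- 1) ^ (n - i))"
      unfolding distrib_left power_minus[of "real q"] by (simp only:)
  qed
  also have "\<dots> = - (\<Prod>i<k. real q ^ (n - i) + (- 1) ^ (n - i))"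
    using prod_alternating[of t n] assms(1) t by (simp add: prod.distrib)
  also have "(\<Prod>i<k. real q ^ (n - i) + (- 1) ^ (n - i)) =
      (\<Prod>i = 1..k. real q ^ (n - i + 1) + (- 1) ^ (n - i + 1))"
    by (rule prod.reindex_bij_witness[of _ "\<lambda>i. i - 1" Suc])
      (use assms(1) in \<open>auto simp: Suc_diff_Suc\<close>)
  finally show ?thesis .
qed

section \<open>Expansion of the square and comparison with the number of invertible matrices\<close>

context hermitian_field
begin

lemma hermitian_mats_diff:
  fixes A B :: "'a mat"
  assumes "A \<in> hermitian_mats q n" "B \<in> hermitian_mats q n"
  shows "A - B \<in> hermitian_mats q n"
proof -
  have carrier: "A \<in> carrier_mat n n" "B \<in> carrier_mat n n"
    using assms by (auto simp: hermitian_mats_def)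
  have entry: "M $$ (j, i) ^ q = M $$ (i, j)" if "M \<in> hermitian_mats q n" "i < n" "j < n"
    for M :: "'a mat" and i j
  proof -
    have "M \<in> carrier_mat n n"
      using that(1) by (simp add: hermitian_mats_def)
    then have "transpose_mat (map_mat (\<lambda>x. x ^ q) M) $$ (i, j) = M $$ (j, i) ^ q"
      using that(2,3) by simp
    moreover have "transpose_mat (map_mat (\<lambda>x. x ^ q) M) = M"
      using that(1) by (simp add: hermitian_mats_def)
    ultimately show ?thesis
      by simp
  qed
  have conj_diff: "(x - y) ^ q = x ^ q - y ^ q" for x y :: 'a
    using conj_add[of x "- y"] by (simp add: conj_minus)
  have "transpose_mat (map_mat (\<lambda>x. x ^ q) (A - B)) = A - B"
    using carrier by (intro eq_matI) (auto simp: conj_diff entry[OF assms(1)] entry[OF assms(2)])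
  then show ?thesis
    using carrier by (simp add: hermitian_mats_def minus_carrier_mat)
qed

lemma mat_form_diff:
  assumes "A \<in> carrier_mat n n" "B \<in> carrier_mat n n"
  shows "mat_form n (A - B) x = mat_form n A x - mat_form n B x"
  using assms by (simp add: mat_form_def algebra_simps sum_subtractf)

theorem card_constant_rank_distance_set_le:
  fixes U :: "'a mat set"
  assumes k: "k \<le> n" "[k = 2] (mod 4)"
    and U: "U \<subseteq> hermitian_mats q n" "constant_rank_distance_set n k U"
  shows "real (card U) \<le> 1 + (\<Prod>i = 1..k. real q ^ (n - i + 1) + (- 1) ^ (n - i + 1))"
    (is "_ \<le> 1 + ?R")
proof -
  \<comment> \<open>The exponent is at least 1, so the power of \<open>q\<close> exceeds 1 and a
    sign of \<open>- 1\<close> cannot cancel it.\<close>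
  have factor: "0 < real q ^ (n - i + 1) + (- 1) ^ (n - i + 1)" for i
  proof -
    have "1 < real q ^ (n - i + 1)"
      using q_gt_1 by (intro one_less_power) auto
    moreover have "- 1 \<le> (- 1 :: real) ^ (n - i + 1)"
      unfolding minus_one_power_iff by simp
    ultimately show ?thesis by linarith
  qed
  have R: "0 < ?R"
    by (rule prod_pos) (use factor in blast)
  show ?thesis
  proof (cases "card U = 0")
    case True
    then have "real (card U) = 0"
      by simp
    then show ?thesis
      using R by linarith
  next
    case False
    let ?L = "full_rank_rows n n :: (nat \<Rightarrow> 'a) list set"
    let ?u = "card U" and ?N = "card ?L" and ?b = "- real q"
    define tr where "tr xs A = (\<Sum>x\<leftarrow>xs. mat_form n A x)" for xs A
    \<comment> \<open>\<open>F\<close> is the character sum at a hermitian matrix of rank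
      \<open>k\<close>, taken in the reals so that signs can be compared.\<close>
    define F where "F = (\<Prod>i=k..<n. ?b ^ (2 * n) - ?b ^ (2 * i)) * (\<Prod>i<k. ?b ^ (n + i) - ?b ^ (2 * i))"
    have fin: "finite U"
      by (rule card_ge_0_finite) (use False in simp)
    have carrier: "A \<in> carrier_mat n n" if "A \<in> U" for A
      using U(1) that by (auto simp: hermitian_mats_def)
    have tr_diff: "tr xs (A - B) = tr xs A - tr xs B" if "A \<in> U" "B \<in> U" for xs A B
      unfolding tr_def using that carrier by (induction xs) (auto simp: mat_form_diff)
    have chi_diff: "\<chi> (tr xs (A - B)) = \<chi> (tr xs A) * cnj (\<chi> (tr xs B))" if "A \<in> U" "B \<in> U" for xs A B
      using chi_add[of "tr xs A" "- tr xs B"] by (simp add: tr_diff[OF that] chi_minus)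
    have off_diagonal: "(\<Sum>xs\<in>?L. \<chi> (tr xs (A - B))) = of_real F"
      if "A \<in> U" "B \<in> U" "A \<noteq> B" for A B
    proof -
      have "vec_space.rank n (A - B) = k"
        using U(2) that by (simp add: constant_rank_distance_set_def)
      moreover have "A - B \<in> hermitian_mats q n"
        using U(1) that by (intro hermitian_mats_diff) auto
      ultimately show ?thesis
        using sum_chi_mat_form(2)[of "A - B" n] by (simp add: tr_def F_def)
    qed
    have diagonal: "(\<Sum>xs\<in>?L. \<chi> (tr xs (A - A))) = of_nat ?N" if "A \<in> U" for A
      using that by (simp add: tr_diff)
    have "of_real (\<Sum>xs\<in>?L. (norm (\<Sum>A\<in>U. \<chi> (tr xs A)))\<^sup>2) =
        (\<Sum>xs\<in>?L. (\<Sum>A\<in>U. \<chi> (tr xs A)) * cnj (\<Sum>A\<in>U. \<chi> (tr xs A)))"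
      by (simp only: of_real_sum complex_norm_square)
    also have "\<dots> = (\<Sum>xs\<in>?L. \<Sum>A\<in>U. \<Sum>B\<in>U. \<chi> (tr xs (A - B)))"
      by (intro sum.cong refl) (simp add: sum_product chi_diff)
    also have "\<dots> = (\<Sum>A\<in>U. \<Sum>xs\<in>?L. \<Sum>B\<in>U. \<chi> (tr xs (A - B)))"
      by (rule sum.swap)
    also have "\<dots> = (\<Sum>A\<in>U. \<Sum>B\<in>U. \<Sum>xs\<in>?L. \<chi> (tr xs (A - B)))"
      by (intro sum.cong refl sum.swap)
    also have "\<dots> = (\<Sum>A\<in>U. of_nat ?N + of_nat (?u - 1) * of_real F)"
    proof (rule sum.cong[OF refl])
      fix A assume A: "A \<in> U"
      have "(\<Sum>B\<in>U. \<Sum>xs\<in>?L. \<chi> (tr xs (A - B))) =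
          of_nat ?N + (\<Sum>B\<in>U - {A}. \<Sum>xs\<in>?L. \<chi> (tr xs (A - B)))"
        using fin A by (simp only: sum.remove diagonal)
      also have "(\<Sum>B\<in>U - {A}. \<Sum>xs\<in>?L. \<chi> (tr xs (A - B))) = (\<Sum>B\<in>U - {A}. of_real F)"
        using A by (intro sum.cong refl off_diagonal) auto
      finally show "(\<Sum>B\<in>U. \<Sum>xs\<in>?L. \<chi> (tr xs (A - B))) = of_nat ?N + of_nat (?u - 1) * of_real F"
        using A fin by simp
    qed
    also have "\<dots> = of_real (real ?u * (real ?N + real (?u - 1) * F))"
      by simp
    finally have "(\<Sum>xs\<in>?L. (norm (\<Sum>A\<in>U. \<chi> (tr xs A)))\<^sup>2) = real ?u * (real ?N + real (?u - 1) * F)"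
      by (simp only: of_real_eq_iff)
    moreover have "0 \<le> (\<Sum>xs\<in>?L. (norm (\<Sum>A\<in>U. \<chi> (tr xs A)))\<^sup>2)"
      by (intro sum_nonneg) simp
    ultimately have pos: "0 \<le> real ?N + real (?u - 1) * F"
      using False by (simp add: zero_le_mult_iff)
    have "complex_of_real (real ?N) = complex_of_real (\<Prod>i<n. ?b ^ (2 * n) - ?b ^ (2 * i))"
      using card_full_rank_rows[of n n, where 'a = 'a] by (simp add: card_field power_mult)
    then have N: "real ?N = (\<Prod>i<n. ?b ^ (2 * n) - ?b ^ (2 * i))"
      by (simp only: of_real_eq_iff)
    also have "\<dots> = (\<Prod>i=k..<n. ?b ^ (2 * n) - ?b ^ (2 * i)) * (\<Prod>i<k. ?b ^ (2 * n) - ?b ^ (2 * i))"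
      using k(1) prod.atLeastLessThan_concat[of 0 k n "\<lambda>i. ?b ^ (2 * n) - ?b ^ (2 * i)"]
      by (simp add: atLeast0LessThan mult.commute)
    \<comment> \<open>Each factor of the count contains the corresponding factor of
      \<open>F\<close>, and the cofactors are those of \<open>prod_neg_base\<close>.\<close>
    also have "(\<Prod>i<k. ?b ^ (2 * n) - ?b ^ (2 * i)) =
        (\<Prod>i<k. (?b ^ (n + i) - ?b ^ (2 * i)) * (?b ^ (n - i) + 1))"
    proof (intro prod.cong refl)
      fix i assume "i \<in> {..<k}"
      then have n: "n = (n - i) + i"
        using k(1) by simp
      have "(x * y) * (x * y) - y * y = ((x * y) * y - y * y) * (x + 1)" for x y :: real
        by (simp add: algebra_simps)
      from this[of "?b ^ (n - i)" "?b ^ i"]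
      show "?b ^ (2 * n) - ?b ^ (2 * i) = (?b ^ (n + i) - ?b ^ (2 * i)) * (?b ^ (n - i) + 1)"
        unfolding power_add[symmetric] mult_2 n[symmetric] .
    qed
    finally have NF: "real ?N = - (F * ?R)"
      unfolding prod.distrib prod_neg_base[OF k] F_def by simp
    have "?b ^ (2 * n) - ?b ^ (2 * i) \<noteq> 0" if "i < n" for i
    proof -
      have "real q ^ (2 * i) < real q ^ (2 * n)"
        using that q_gt_1 by (intro power_strict_increasing) auto
      then show ?thesis by simp
    qed
    then have "real ?N \<noteq> 0"
      unfolding N by (simp add: prod_zero_iff)
    then have N_pos: "0 < real ?N"
      using of_nat_0_le_iff[of ?N, where 'a = real] by linarith
    \<comment> \<open>Multiplying by the positive \<open>?R\<close> turns \<open>F * ?R\<close> into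
      \<open>- ?N\<close>; the sign of \<open>F\<close> then needs no discussion, and the positive
      \<open>?N\<close> cancels.\<close>
    have "0 \<le> (real ?N + real (?u - 1) * F) * ?R"
      using pos R by simp
    also have "\<dots> = real ?N * (?R - real (?u - 1))"
      using NF by (simp add: algebra_simps)
    finally have "real (?u - 1) \<le> ?R"
      using N_pos mult_pos_neg[of "real ?N" "?R - real (?u - 1)"] by linarith
    then show ?thesis
      using False by simp
  qed
qed

end

theorem theorem4p5:
  fixes q n k :: nat and U :: "'a :: {field, finite} mat set"
  assumes "primepow q"
    and "CARD('a) = q ^ 2"
    and "n \<ge> 1"
    and "1 \<le> k" and "k \<le> n"
    and "[k = 2] (mod 4)"
    and "U \<subseteq> hermitian_mats q n"
    and "constant_rank_distance_set n k U"
  shows "int (card U) \<le> 1 + (\<Prod>i = 1..k. int q ^ (n - i + 1) + (-1) ^ (n - i + 1))"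
proof -
  obtain p e where "prime p" "e > 0" "q = p ^ e"
    using assms(1) by (auto simp: primepow_def)
  then have "primepow CARD('a)"
    unfolding assms(2) primepow_def by (intro exI[of _ p] exI[of _ "e * 2"]) (simp add: power_mult)
  then obtain \<chi> :: "'a \<Rightarrow> complex" where "\<And>x y. \<chi> (x + y) = \<chi> x * \<chi> y" "\<And>x. norm (\<chi> x) = 1" "\<chi> 1 \<noteq> 1"
    using exists_additive_character by blast
  then interpret hermitian_field q \<chi>
    using assms(1,2) by unfold_locales
  have "real_of_int (int (card U)) \<le>
      real_of_int (1 + (\<Prod>i = 1..k. int q ^ (n - i + 1) + (-1) ^ (n - i + 1)))"
    using card_constant_rank_distance_set_le[OF assms(5-8)] by simp
  then show ?thesis
    by (simp only: of_int_le_iff)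
qed

end
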